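(* Let $m$ and $n$ be positive integers with $n$ even, $2 \leq n \leq \lfloor m/2 \rfloor - 1$, and let $f(x) = x^m + x^{n+1} + x^n + x + 1 \in \mathbb{F}_2[x]$. Suppose $m$ is even and $n > 2$. Then $f(x)$ has an even number of irreducible factors over $\mathbb{F}_2$ if and only if one of the following conditions holds: (1) $n \equiv 0 \pmod 4$ and $m \equiv 0$ or $2 \pmod 8$; (2) $n \neq 6$, $n \equiv 2 \pmod 4$, and either (a) $((2m+4) \bmod n) \leq 6$ and $m \equiv 4$ or $6 \pmod 8$, or (b) $((2m+4) \bmod n) > 6$ and $m \equiv 0$ or $2 \pmod 8$; (3) $n = 6$, and either (c) $((2m+4) \bmod n) = 0$ and $m \equiv 0$ or $2 \pmod 8$, or (d) $((2m+4) \bmod n) \neq 0$ and $m \equiv 4$ or $6 \pmod 8$.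
   Context: For an integer $a$ and a positive integer $n$, $(a \bmod n)$ denotes the remainder of $a$ on division by $n$, lying in $\{0, 1, \dots, n-1\}$. $\mathbb{F}_2$ is the field with two elements. *)

theory Defs
  imports
    "HOL-Computational_Algebra.Polynomial_Factorial"
    "Berlekamp_Zassenhaus.Finite_Field"
begin

text \<open>
  The type \<^typ>\<open>'a mod_ring\<close> is the ring of integers modulo the cardinality of \<open>'a\<close>.
  Since \<^typ>\<open>bool\<close> has two elements, the following is the prime field with two elements.
\<close>

type_synonym gf2 = "bool mod_ring"

text \<open>
  The number of factors in the factorization of a nonzero polynomial into irreducibles,
  counted with multiplicity.  Each class of associated irreducibles is represented by its
  monic member; over \<^typ>\<open>gf2\<close> every nonzero polynomial is monic.
\<close>

definition num_irreducible_factors :: "'a::field_gcd poly \<Rightarrow> nat" where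
  "num_irreducible_factors f =
     (\<Sum>p | irreducible p \<and> lead_coeff p = 1 \<and> p dvd f. multiplicity p f)"

lemma num_irreducible_factors_eq_size_prime_factorization:
  fixes f :: "'a::field_gcd poly"
  assumes "f \<noteq> 0"
  shows "num_irreducible_factors f = size (prime_factorization f)"
proof -
  have monic_iff: "lead_coeff p = 1 \<longleftrightarrow> normalize p = p" if "p \<noteq> 0" for p :: "'a poly"
  proof
    assume "lead_coeff p = 1"
    then show "normalize p = p" by (simp add: normalize_poly_eq_map_poly)
  next
    assume "normalize p = p"
    then have "lead_coeff p = lead_coeff p div unit_factor (lead_coeff p)"
      by (metis coeff_normalize)
    also have "\<dots> = 1"
      using that by (simp add: is_unit_unit_factor dvd_field_iff)
    finally show "lead_coeff p = 1" .
  qed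
  have eq: "{p. irreducible p \<and> lead_coeff p = 1 \<and> p dvd f} = prime_factors f"
  proof (rule Set.set_eqI)
    fix p
    show "p \<in> {p. irreducible p \<and> lead_coeff p = 1 \<and> p dvd f} \<longleftrightarrow> p \<in> prime_factors f"
    proof (cases "p = 0")
      case False
      have "irreducible p \<and> lead_coeff p = 1 \<longleftrightarrow> prime p"
        unfolding prime_def prime_elem_iff_irreducible monic_iff[OF False] ..
      then show ?thesis
        using assms unfolding prime_factors_dvd[OF assms] by blast
    qed (use assms in \<open>simp add: prime_factors_dvd\<close>)
  qed
  have "num_irreducible_factors f = (\<Sum>p\<in>prime_factors f. multiplicity p f)"
    unfolding num_irreducible_factors_def eq ..
  also have "\<dots> = (\<Sum>p\<in>prime_factors f. count (prime_factorization f) p)"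
    by (rule sum.cong[OF refl], rule count_prime_factorization_prime[symmetric],
        rule in_prime_factors_imp_prime)
  finally show ?thesis
    unfolding size_multiset_overloaded_eq .
qed

end

theory Submission
  imports
    "HOL-Algebra.Algebraic_Closure_Type"
    Defs
begin

text \<open>
  The parity of the number $r$ of irreducible factors is read off from a discriminant modulo 8.
  Let $f$ be squarefree of degree $m$ over the field with two elements, let $F$ be a monic integer
  polynomial that reduces to $f$, and let $V$ be the product of the differences of the roots of $F$
  in a ring where 2 is not invertible and that carries a lift of the Frobenius map.  Frobenius permutes
  the roots of $f$ in one cycle for each irreducible factor, hence multiplies $V$ by $(-1)^{m-r}$.
  Since $V \equiv 1$ modulo 2, write $V = 1 + 2u$; then $V^2 = 1 + 4(u^2 + u)$, and $u^2 + u$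
  reduces to 0 if Frobenius fixes $V$ and to 1 if Frobenius negates it.  So the discriminant $V^2$ of
  $F$ is 1 or 5 modulo 8 according to the parity of $m - r$; this is the criterion of Stickelberger and
  Swan, \<open>stickelberger_swan\<close>.  Since only residues modulo 8 matter, the ring of Witt vectors of
  length three over an algebraic closure suffices, which is given by explicit polynomials: 8 vanishes, the
  elements with residue 0 are the multiples of 2, and simple roots lift by Newton's method.

  For the pentanomial the convenient lift is $F = x^m + (x+1)(x^n - 1)$.  For even $m$ and a root $x$ the
  elements $x$ and $x^n - 1$ are units, their products over all roots are $-1$ and $1$, and
  $x F'(x) = x (x^n - 1) (1 - 2y)$ where $y$ is a polynomial in $z = 1/x$.  So the discriminant is, up to sign,
  the product of the $1 - 2y$, and modulo 8 this only depends on the sums of $y$ and of $y^2$ over the roots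
  (\<open>prod_one_minus_two_mult\<close>).  These are combinations of power sums of the $z$,
  which come from the expansion of $-x F'/F$ (\<open>power_sums_inverse_roots_pentanomial\<close>):
  up to order $m$ the series sees only the factor $(x+1)(x^n-1)$, and between $m$ and $2m$ there is a
  first-order correction with coefficients that count multiples of $n$.  The exponents that matter are
  near $2m - 2n$, and this is why $2m + 4$ modulo $n$ enters (\<open>odd_half_trace_iff\<close>).
\<close>

section \<open>Witt vectors of length three in characteristic two\<close>

class char_two_ring = comm_ring_1 +
  assumes one_plus_one_eq_0: "1 + 1 = 0"
begin

lemma add_self_eq_0: "a + a = 0"
  by (metis distrib_left mult_1_right mult_zero_right one_plus_one_eq_0)

lemma add_self_left: "a + (a + b) = b"
  by (simp add: add_self_eq_0 flip: add.assoc)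

lemma minus_eq_self: "- a = a"
  using add_self_eq_0 minus_unique by blast

lemma diff_eq_plus: "a - b = a + b"
  unfolding diff_conv_add_uminus minus_eq_self ..

lemma square_add: "(a + b)^2 = a^2 + b^2"
  by (simp add: power2_eq_square algebra_simps add_self_eq_0 add_self_left)

end

lemmas char_two_simps = add_self_eq_0 add_self_left minus_eq_self diff_eq_plus

text \<open>
  The operations below are determined by the ghost components $a_0$, $a_0^2 + 2 a_1$ and
  $a_0^4 + 2 a_1^2 + 4 a_2$: addition and multiplication of these over the integers yields integer polynomials
  in the $a_i$ and $b_i$, which are here reduced modulo 2.
\<close>

datatype 'a witt3 = Witt (w0: 'a) (w1: 'a) (w2: 'a)

instantiation witt3 :: (char_two_ring) comm_ring_1
begin

definition "0 = Witt 0 0 0"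
definition "1 = Witt 1 0 0"

fun plus_witt3 :: "'a witt3 \<Rightarrow> 'a witt3 \<Rightarrow> 'a witt3" where
  "Witt a0 a1 a2 + Witt b0 b1 b2 =
     Witt (a0 + b0) (a1 + b1 + a0 * b0)
       (a2 + b2 + a1 * b1 + (a1 + b1) * a0 * b0 + a0^3 * b0 + a0 * b0^3)"

fun times_witt3 :: "'a witt3 \<Rightarrow> 'a witt3 \<Rightarrow> 'a witt3" where
  "Witt a0 a1 a2 * Witt b0 b1 b2 =
     Witt (a0 * b0) (a0^2 * b1 + a1 * b0^2)
       (a0^4 * b2 + a2 * b0^4 + a1^2 * b1^2 + a0^2 * a1 * b0^2 * b1)"

fun uminus_witt3 :: "'a witt3 \<Rightarrow> 'a witt3" where
  "- Witt a0 a1 a2 = Witt a0 (a1 + a0^2) (a2 + a1^2 + a1 * a0^2 + a0^4)"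

definition "a - b = a + - (b :: 'a witt3)"

instance
proof
  fix a b c :: "'a witt3"
  show "a + b + c = a + (b + c)"
    by (cases a; cases b; cases c)
      (simp add: algebra_simps char_two_simps power3_eq_cube power2_eq_square power4_eq_xxxx)
  show "a + b = b + a"
    by (cases a; cases b) (simp add: algebra_simps)
  show "0 + a = a"
    by (cases a) (simp add: zero_witt3_def)
  show "- a + a = 0"
    by (cases a)
      (simp add: zero_witt3_def algebra_simps char_two_simps power3_eq_cube power2_eq_square power4_eq_xxxx)
  show "a - b = a + - b"
    by (rule minus_witt3_def)
  show "a * b * c = a * (b * c)"
    by (cases a; cases b; cases c)
      (simp add: algebra_simps char_two_simps power3_eq_cube power2_eq_square power4_eq_xxxx)
  show "a * b = b * a"
    by (cases a; cases b) (simp add: algebra_simps)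
  show "1 * a = a"
    by (cases a) (simp add: one_witt3_def)
  show "(a + b) * c = a * c + b * c"
    by (cases a; cases b; cases c)
      (simp add: algebra_simps char_two_simps power3_eq_cube power2_eq_square power4_eq_xxxx)
  show "(0 :: 'a witt3) \<noteq> 1"
    by (simp add: zero_witt3_def one_witt3_def)
qed

end

lemma w0_simps [simp]:
  "w0 0 = 0" "w0 1 = 1" "w0 (a + b) = w0 a + w0 b" "w0 (a * b) = w0 a * w0 b"
  "w0 (- a) = - w0 a" "w0 (a - b) = w0 a - w0 b"
  by (cases a; cases b; simp add: zero_witt3_def one_witt3_def minus_witt3_def char_two_simps)+

interpretation w0_hom: comm_ring_hom "w0 :: 'a::char_two_ring witt3 \<Rightarrow> 'a"
  by unfold_locales simp_all

text \<open>
  Squaring is a ring endomorphism of the coefficients and the Witt polynomials have coefficients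
  in the prime field, so squaring all components is a ring endomorphism that lifts squaring modulo 2.
\<close>

fun frob :: "'a::char_two_ring witt3 \<Rightarrow> 'a witt3" where
  "frob (Witt a0 a1 a2) = Witt (a0^2) (a1^2) (a2^2)"

lemma frob_simps:
  "frob 0 = 0" "frob 1 = 1" "frob (a + b) = frob a + frob b" "frob (a * b) = frob a * frob b"
  by (cases a; cases b;
      simp add: zero_witt3_def one_witt3_def square_add power_mult_distrib flip: power_mult;
      simp add: mult.commute)+

interpretation frob_hom: comm_ring_hom "frob :: 'a::char_two_ring witt3 \<Rightarrow> 'a witt3"
  by unfold_locales (simp_all add: frob_simps)

lemma w0_frob [simp]: "w0 (frob a) = (w0 a)^2"
  by (cases a) simp

text \<open>
  Doubling is the shift followed by the Frobenius endomorphism.  All facts below about divisibility by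
  2, 4 and 8 follow from this formula.
\<close>

lemma two_mult_Witt: "2 * Witt a0 a1 a2 = Witt 0 (a0^2) (a1^2)"
  unfolding mult_2
  by (simp add: char_two_simps power2_eq_square algebra_simps)

lemma witt3_eight: "(8 :: 'a::char_two_ring witt3) = 0"
proof -
  have "(8 :: 'a witt3) = 2 * (2 * (2 * Witt 1 0 0))" by (simp flip: one_witt3_def)
  then show ?thesis by (simp add: two_mult_Witt zero_witt3_def)
qed

text \<open>
  Over a perfect field the components of a shifted vector have square roots, so the shift of a
  vector is a double.
\<close>

lemma w0_eq_0_imp_even:
  fixes a :: "'a::{char_two_ring, alg_closed_field} witt3"
  assumes "w0 a = 0"
  obtains b where "a = 2 * b"
proof (cases a)
  case (Witt a0 a1 a2)
  obtain r s where "r^2 = a1" "s^2 = a2"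
    using nth_root_exists[of 2] by (metis zero_less_numeral)
  then have "a = 2 * Witt r s 0"
    using assms Witt by (simp add: two_mult_Witt)
  then show thesis by (rule that)
qed

lemma two_mult_eq_0_imp:
  fixes a :: "'a::{char_two_ring, idom} witt3"
  assumes "2 * a = 0"
  shows "w0 a = 0"
  using assms by (cases a) (simp add: two_mult_Witt zero_witt3_def)

lemma four_mult_eq_0_iff:
  fixes a :: "'a::{char_two_ring, alg_closed_field} witt3"
  shows "4 * a = 0 \<longleftrightarrow> w0 a = 0"
proof -
  have "4 * a = 2 * (2 * a)" by (simp add: mult.assoc[symmetric])
  then show ?thesis by (cases a) (simp add: two_mult_Witt zero_witt3_def)
qed

text \<open>
  Lift an inverse of the residue; the error is a multiple of 2, hence nilpotent, and a geometric series
  removes it.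
\<close>

lemma witt3_unit:
  fixes a :: "'a::{char_two_ring, alg_closed_field} witt3"
  assumes "w0 a \<noteq> 0"
  obtains b where "a * b = 1"
proof -
  have "w0 (1 - a * Witt (inverse (w0 a)) 0 0) = 0" using assms by simp
  then obtain c where c: "1 - a * Witt (inverse (w0 a)) 0 0 = 2 * c"
    by (rule w0_eq_0_imp_even)
  define d where "d = Witt (inverse (w0 a)) 0 0"
  have "a * (d * (1 + 2 * c + 4 * c^2)) = (1 - (1 - a * d)) * (1 + 2 * c + 4 * c^2)"
    by (simp add: mult.assoc)
  also have "\<dots> = (1 - 2 * c) * (1 + 2 * c + 4 * c^2)"
    unfolding d_def c ..
  also have "\<dots> = 1 - 8 * c^3"
    by (simp add: algebra_simps power2_eq_square power3_eq_cube)
  also have "\<dots> = 1" by (simp add: witt3_eight)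
  finally show thesis by (rule that)
qed

section \<open>Formal derivatives, lifting of roots and Vandermonde products\<close>

text \<open>
  Truncated Witt vectors have zero divisors, whereas \<^const>\<open>pderiv\<close> presupposes that there are none.
\<close>

definition formal_deriv :: "'a::comm_ring_1 poly \<Rightarrow> 'a poly" where
  "formal_deriv p = (\<Sum>i\<le>degree p. monom (of_nat (Suc i) * coeff p (Suc i)) i)"

lemma coeff_formal_deriv: "coeff (formal_deriv p) i = of_nat (Suc i) * coeff p (Suc i)"
  by (cases "i \<le> degree p")
    (auto simp: formal_deriv_def coeff_sum sum.delta if_distrib[of "\<lambda>x. _ * x"] coeff_eq_0 cong: if_cong)

lemma formal_deriv_0 [simp]: "formal_deriv 0 = 0"
  by (rule poly_eqI) (simp add: coeff_formal_deriv)

lemma formal_deriv_1 [simp]: "formal_deriv 1 = 0"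
  by (rule poly_eqI) (simp add: coeff_formal_deriv)

lemma formal_deriv_add: "formal_deriv (p + q) = formal_deriv p + formal_deriv q"
  by (rule poly_eqI) (simp add: coeff_formal_deriv algebra_simps)

lemma formal_deriv_diff: "formal_deriv (p - q) = formal_deriv p - formal_deriv q"
  by (rule poly_eqI) (simp add: coeff_formal_deriv algebra_simps)

lemma formal_deriv_smult: "formal_deriv (smult c p) = smult c (formal_deriv p)"
  by (rule poly_eqI) (simp add: coeff_formal_deriv algebra_simps)

lemma formal_deriv_monom: "formal_deriv (monom c n) = monom (of_nat n * c) (n - 1)"
  by (rule poly_eqI, cases n) (auto simp: coeff_formal_deriv)

lemma formal_deriv_pCons: "formal_deriv (pCons a p) = p + pCons 0 (formal_deriv p)"
  by (rule poly_eqI) (auto simp: coeff_formal_deriv coeff_pCons algebra_simps split: nat.split)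

lemma formal_deriv_linear_mult:
  fixes a :: "'a::comm_ring_1"
  shows "formal_deriv ([:- a, 1:] * q) = q + [:- a, 1:] * formal_deriv q"
proof -
  have "[:- a, 1:] * q = pCons 0 q - smult a q" by simp
  then show ?thesis
    by (simp add: formal_deriv_diff formal_deriv_smult formal_deriv_pCons)
qed

lemma poly_formal_deriv_map:
  assumes "comm_ring_hom h"
  shows "poly (formal_deriv (map_poly h p)) (h a) = h (poly (formal_deriv p) a)"
proof -
  interpret comm_ring_hom h by fact
  have "formal_deriv (map_poly h p) = map_poly h (formal_deriv p)"
    by (rule poly_eqI) (simp add: coeff_formal_deriv hom_distribs)
  then show ?thesis by simp
qed

lemma poly_add_expand:
  "\<exists>w. poly p (a + h) = poly p a + h * poly (formal_deriv p) a + h^2 * w"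
proof (induction p)
  case (pCons c p)
  then obtain w where w: "poly p (a + h) = poly p a + h * poly (formal_deriv p) a + h^2 * w"
    by blast
  have "poly (pCons c p) (a + h) = poly (pCons c p) a + h * poly (formal_deriv (pCons c p)) a
      + h^2 * (a * w + poly (formal_deriv p) a + h * w)"
    by (simp add: w formal_deriv_pCons algebra_simps power2_eq_square)
  then show ?case ..
qed (auto intro: exI[of _ 0])

lemma hensel_unique:
  fixes p :: "'a::{char_two_ring, alg_closed_field} witt3 poly"
  assumes "poly p a = 0" "poly p b = 0" "w0 a = w0 b" "w0 (poly (formal_deriv p) a) \<noteq> 0"
  shows "a = b"
proof -
  obtain w where w: "poly p (a + (b - a)) =
      poly p a + (b - a) * poly (formal_deriv p) a + (b - a)^2 * w"
    using poly_add_expand by blast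
  have "(b - a) * (poly (formal_deriv p) a + (b - a) * w) = 0"
    using w assms(1,2) by (simp add: algebra_simps power2_eq_square)
  moreover have "w0 (poly (formal_deriv p) a + (b - a) * w) \<noteq> 0"
    using assms(3,4) by simp
  then obtain c where "(poly (formal_deriv p) a + (b - a) * w) * c = 1"
    by (rule witt3_unit)
  ultimately have "b - a = 0"
    by (metis mult.assoc mult.right_neutral mult_zero_left)
  then show ?thesis by simp
qed

text \<open>
  Two Newton steps suffice: the value of \<open>p\<close> is a multiple of 2 at first, then of 4, then of 16.
\<close>

lemma hensel_lift:
  fixes p :: "'a::{char_two_ring, alg_closed_field} witt3 poly"
  assumes "w0 (poly p a) = 0" "w0 (poly (formal_deriv p) a) \<noteq> 0"
  obtains b where "w0 b = w0 a" "poly p b = 0"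
proof -
  have step: "\<exists>b e'. w0 b = w0 a \<and> poly p b = e^2 * e'"
    if c: "w0 c = w0 a" "poly p c = e" "w0 e = 0" for c e
  proof -
    have "w0 (poly (formal_deriv p) c) = w0 (poly (formal_deriv p) a)"
      using c(1) by (metis poly_formal_deriv_map w0_hom.comm_ring_hom_axioms)
    then obtain u where u: "poly (formal_deriv p) c * u = 1"
      using assms(2) witt3_unit by metis
    obtain w where w: "poly p (c + (- e * u)) =
        poly p c + (- e * u) * poly (formal_deriv p) c + (- e * u)^2 * w"
      using poly_add_expand by blast
    have "poly p c + (- e * u) * poly (formal_deriv p) c = 0"
      using u c(2) by (simp add: mult.assoc mult.commute[of u])
    then have "poly p (c + (- e * u)) = e^2 * (u^2 * w)"
      using w by (simp add: power_mult_distrib mult.assoc)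
    then show ?thesis
      using c by (intro exI[of _ "c + (- e * u)"] exI[of _ "u^2 * w"]) simp
  qed
  obtain d where d: "poly p a = 2 * d"
    using assms(1) by (rule w0_eq_0_imp_even)
  obtain a' e' where a': "w0 a' = w0 a" "poly p a' = (poly p a)^2 * e'"
    using step[OF refl refl assms(1)] by blast
  have e: "w0 (poly p a') = 0"
    using a'(2) assms(1) by (simp add: power2_eq_square)
  obtain b e'' where b: "w0 b = w0 a" "poly p b = (poly p a')^2 * e''"
    using step[OF a'(1) refl e] by blast
  have "poly p b = 8 * (2 * d^4 * e'^2 * e'')"
    unfolding b(2) a'(2) d by (simp add: power_mult_distrib flip: power_mult)
  then show thesis
    using b(1) that by (simp add: witt3_eight)
qed

definition roots_poly :: "'a::comm_ring_1 list \<Rightarrow> 'a poly" where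
  "roots_poly xs = (\<Prod>x\<leftarrow>xs. [:- x, 1:])"

lemma roots_poly_simps [simp]:
  "roots_poly [] = 1" "roots_poly (x # xs) = [:- x, 1:] * roots_poly xs"
  by (simp_all add: roots_poly_def)

lemma poly_roots_poly: "poly (roots_poly xs) a = (\<Prod>x\<leftarrow>xs. a - x)"
  by (induction xs) (simp_all add: algebra_simps)

text \<open>
  Over a ring with zero divisors the linear factors can only be split off one after the other when the
  differences of the roots can be cancelled.
\<close>

lemma eq_roots_polyI:
  fixes p :: "'a::comm_ring_1 poly"
  assumes "degree p = length xs" "lead_coeff p = 1" "distinct xs"
    and "\<And>x. x \<in> set xs \<Longrightarrow> poly p x = 0"
    and "\<And>x y c. x \<in> set xs \<Longrightarrow> y \<in> set xs \<Longrightarrow> x \<noteq> y \<Longrightarrow> (x - y) * c = 0 \<Longrightarrow> c = 0"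
  shows "p = roots_poly xs"
  using assms
proof (induction xs arbitrary: p)
  case Nil
  then show ?case
    by (auto elim!: degree_eq_zeroE simp: one_pCons)
next
  case (Cons a xs)
  define q where "q = synthetic_div p a"
  have p: "p = [:- a, 1:] * q"
    using synthetic_div_correct'[of a p] Cons.prems(4)[of a] by (simp add: q_def)
  have deg: "degree q = length xs"
    unfolding q_def degree_synthetic_div using Cons.prems(1) by simp
  have "coeff p (Suc (length xs)) = coeff q (length xs)"
    using deg by (simp add: p coeff_eq_0)
  then have lc: "lead_coeff q = 1"
    using Cons.prems(1,2) deg by simp
  have roots: "poly q x = 0" if "x \<in> set xs" for x
  proof (rule Cons.prems(5)[of x a])
    show "(x - a) * poly q x = 0"
      using Cons.prems(4)[of x] that by (simp add: p algebra_simps)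
    show "x \<noteq> a" using Cons.prems(3) that by auto
  qed (use that in auto)
  have "q = roots_poly xs"
  proof (rule Cons.IH[OF deg lc])
    show "distinct xs" using Cons.prems(3) by simp
    show "poly q x = 0" if "x \<in> set xs" for x using that by (rule roots)
    show "c = 0" if "x \<in> set xs" "y \<in> set xs" "x \<noteq> y" "(x - y) * c = 0" for x y c
      using that Cons.prems(5)[of x y c] by simp
  qed
  then show ?case by (simp only: p roots_poly_simps)
qed

primrec vandermonde :: "'a::comm_ring_1 list \<Rightarrow> 'a" where
  "vandermonde [] = 1"
| "vandermonde (x # xs) = (\<Prod>y\<leftarrow>xs. x - y) * vandermonde xs"

lemma vandermonde_append: "vandermonde (xs @ ys) = vandermonde xs * vandermonde ys * (\<Prod>x\<leftarrow>xs. \<Prod>y\<leftarrow>ys. x - y)"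
  by (induction xs) (simp_all add: mult_ac)

lemma prod_list_diff_commute:
  fixes x :: "'a::comm_ring_1"
  shows "(\<Prod>y\<leftarrow>xs. y - x) = (-1) ^ length xs * (\<Prod>y\<leftarrow>xs. x - y)"
  by (induction xs) (simp_all add: algebra_simps)

text \<open>
  The Frobenius map rotates the roots of an irreducible polynomial, so this sign is what
  an irreducible factor contributes.
\<close>

lemma vandermonde_rotate: "vandermonde (xs @ [x]) = (-1) ^ length xs * vandermonde (x # xs)"
  by (simp add: vandermonde_append prod_list_diff_commute mult_ac)

lemma prod_list_mult_distrib:
  fixes f g :: "'b \<Rightarrow> 'a::comm_monoid_mult"
  shows "(\<Prod>x\<leftarrow>xs. f x * g x) = (\<Prod>x\<leftarrow>xs. f x) * (\<Prod>x\<leftarrow>xs. g x)"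
  by (induction xs) (simp_all add: mult_ac)

text \<open>
  Both sides are the discriminant: the left one runs over ordered pairs of roots, and
  identifying \<open>x - y\<close> with \<open>y - x\<close> costs one sign for each unordered pair.
\<close>

lemma prod_formal_deriv_roots:
  "(\<Prod>x\<leftarrow>xs. poly (formal_deriv (roots_poly xs)) x) =
     (-1) ^ (length xs * (length xs - 1) div 2) * (vandermonde xs)^2"
proof (induction xs)
  case (Cons a xs)
  have *: "poly (formal_deriv (roots_poly (a # xs))) x =
      poly (roots_poly xs) x + (x - a) * poly (formal_deriv (roots_poly xs)) x" for x
    unfolding roots_poly_simps formal_deriv_linear_mult by (simp add: algebra_simps)
  have root: "poly (roots_poly xs) x = 0" if "x \<in> set xs" for x
    using that by (induction xs) auto
  have "(\<Prod>x\<leftarrow>xs. poly (formal_deriv (roots_poly (a # xs))) x) =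
      (\<Prod>x\<leftarrow>xs. (x - a) * poly (formal_deriv (roots_poly xs)) x)"
    by (rule arg_cong[of _ _ prod_list], rule map_cong) (simp_all add: * root del: roots_poly_simps)
  also have "\<dots> = (\<Prod>x\<leftarrow>xs. x - a) * (\<Prod>x\<leftarrow>xs. poly (formal_deriv (roots_poly xs)) x)"
    by (rule prod_list_mult_distrib)
  also have "\<dots> = (-1) ^ length xs * (\<Prod>x\<leftarrow>xs. a - x) *
      ((-1) ^ (length xs * (length xs - 1) div 2) * (vandermonde xs)^2)"
    by (simp add: prod_list_diff_commute Cons.IH)
  finally have tail: "(\<Prod>x\<leftarrow>xs. poly (formal_deriv (roots_poly (a # xs))) x) = \<dots>" .
  have head: "poly (formal_deriv (roots_poly (a # xs))) a = (\<Prod>x\<leftarrow>xs. a - x)"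
    using *[of a] by (simp only: poly_roots_poly) simp
  have "(\<Prod>x\<leftarrow>a # xs. poly (formal_deriv (roots_poly (a # xs))) x) =
      (-1) ^ (length xs + length xs * (length xs - 1) div 2) * (vandermonde (a # xs))^2"
    unfolding list.map prod_list.Cons head tail
    by (simp add: power_add power2_eq_square mult_ac)
  also have "length xs + length xs * (length xs - 1) div 2 = length (a # xs) * (length (a # xs) - 1) div 2"
    by (cases xs) (simp_all add: algebra_simps)
  finally show ?case .
qed simp

section \<open>Frobenius orbits of roots over the field with two elements\<close>

text \<open>
  This class turns \<^typ>\<open>gf2\<close>, and then its algebraic closure, into instances of \<^class>\<open>char_two_ring\<close>.
\<close>

class card_two = prime_card +
  assumes card_eq_two: "CARD('a) = 2"

instance bool :: card_two
  by standard (simp_all)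

instance mod_ring :: (card_two) char_two_ring
proof
  have "of_nat CARD('a) = (0 :: 'a mod_ring)"
    by simp
  then show "1 + 1 = (0 :: 'a mod_ring)"
    by (simp add: card_eq_two)
qed

instance alg_closure :: ("{field, char_two_ring}") char_two_ring
proof
  have "to_ac (1 + 1 :: 'a) = 0" by (simp only: one_plus_one_eq_0 to_ac_0)
  then show "1 + 1 = (0 :: 'a alg_closure)" by (simp only: to_ac_add to_ac_1)
qed

lemma gf2_cases: "x = 0 \<or> x = (1 :: gf2)"
proof -
  have "card (UNIV :: gf2 set) = 2" by simp
  moreover have "{0, 1 :: gf2} \<subseteq> UNIV" "card {0, 1 :: gf2} = 2" by simp_all
  ultimately have "{0, 1 :: gf2} = UNIV"
    by (metis card_subset_eq finite)
  then show ?thesis by (metis UNIV_I insertE singletonD)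
qed

lemma gf2_sq [simp]: "x^2 = (x :: gf2)"
  using gf2_cases[of x] by auto

interpretation to_ac_hom: inj_idom_hom "to_ac :: 'a::field \<Rightarrow> 'a alg_closure"
  by unfold_locales simp_all
interpretation to_ac_poly_hom: map_poly_inj_idom_hom "to_ac :: 'a::field \<Rightarrow> 'a alg_closure" ..

lemma poly_gf2_square:
  "poly (map_poly to_ac p) (x^2) = (poly (map_poly to_ac (p :: gf2 poly)) x)^2"
proof (induction p)
  case (pCons c p)
  have "(to_ac c)^2 = to_ac c" by (metis gf2_sq to_ac_power)
  with pCons.IH show ?case
    by (simp add: square_add power_mult_distrib to_ac_hom.map_poly_pCons_hom)
qed simp

lemma sq_eq_self_imp_range_to_ac:
  assumes "c^2 = (c :: gf2 alg_closure)"
  shows "c \<in> range to_ac"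
proof -
  have "c * (c - 1) = 0" using assms by (simp add: power2_eq_square algebra_simps)
  then have "c = to_ac 0 \<or> c = to_ac 1" by auto
  then show ?thesis by blast
qed

lemma sq_inj:
  fixes x y :: "'a::{char_two_ring, idom}"
  assumes "x^2 = y^2" shows "x = y"
proof -
  have "(x - y)^2 = x^2 + y^2" by (simp add: diff_eq_plus square_add)
  then show ?thesis using assms by (simp add: add_self_eq_0)
qed

lemma pow_two_pow_inj:
  fixes x y :: "'a::{char_two_ring, idom}"
  assumes "x ^ 2 ^ i = y ^ 2 ^ i" shows "x = y"
  using assms
proof (induction i)
  case (Suc i)
  have "(x ^ 2 ^ i)^2 = (y ^ 2 ^ i)^2"
    using Suc.prems by (simp add: mult.commute flip: power_mult)
  then show ?case using Suc.IH sq_inj by blast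
qed simp

lemma irreducible_dvd_of_common_root:
  fixes g h :: "gf2 poly"
  assumes "irreducible g" "poly (map_poly to_ac g) a = 0" "poly (map_poly to_ac h) a = 0"
  shows "g dvd h"
proof (rule ccontr)
  assume "\<not> g dvd h"
  then have "gcd g h = 1"
    using assms(1) by (meson coprime_iff_gcd_eq_1 irreducible_imp_prime_elem prime_elem_imp_coprime)
  then obtain u v where "u * g + v * h = 1"
    by (metis bezout_coefficients_fst_snd)
  then have "poly (map_poly to_ac (u * g + v * h)) a = 1" by simp
  then show False using assms(2,3) by (simp add: hom_distribs)
qed

lemma degree_roots_poly [simp]: "degree (roots_poly xs :: 'a::idom poly) = length xs"
proof (induction xs)
  case (Cons x xs)
  have "roots_poly xs \<noteq> 0" by (auto simp: roots_poly_def prod_list_zero_iff)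
  then show ?case using Cons by (simp add: degree_mult_eq del: mult_pCons_left)
qed simp

lemma roots_poly_mset_cong: "mset xs = mset ys \<Longrightarrow> roots_poly xs = roots_poly ys"
  unfolding roots_poly_def by (metis mset_map prod_mset_prod_list)

lemma map_square_orbit:
  fixes a :: "'a::monoid_mult"
  shows "map (\<lambda>z. z^2) (map (\<lambda>i. a ^ 2 ^ i) [0..<d]) = map (\<lambda>i. a ^ 2 ^ i) [1..<Suc d]"
proof -
  have "[1..<Suc d] = map Suc [0..<d]" by (simp add: map_Suc_upt del: upt_Suc)
  then show ?thesis by (simp add: mult.commute del: upt_Suc flip: power_mult)
qed

text \<open>
  The product of the linear factors over one Frobenius orbit is fixed by squaring its coefficients, hence
  is defined over the prime field; therefore the irreducible polynomial divides it.  Conversely it divides the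
  irreducible polynomial because its roots are distinct roots of it.
\<close>

lemma irreducible_roots_frobenius_orbit:
  fixes g :: "gf2 poly"
  assumes "irreducible g"
  obtains a d where "degree g = d" "d > 0" "a ^ 2 ^ d = a"
    "distinct (map (\<lambda>i. a ^ 2 ^ i) [0..<d])"
    "set (map (\<lambda>i. a ^ 2 ^ i) [0..<d]) = {z. poly (map_poly to_ac g) z = 0}"
proof -
  have g0: "map_poly to_ac g \<noteq> 0" using assms by auto
  have "degree g > 0"
    using assms by (metis is_unit_iff_degree irreducible_def gr0I irreducible_not_unit not_irreducible_zero)
  then obtain a where a: "poly (map_poly to_ac g) a = 0"
    using alg_closed_imp_poly_has_root[of "map_poly to_ac g"] by auto
  have pow_Suc: "x ^ 2 ^ Suc i = (x ^ 2 ^ i)^2" for x :: "gf2 alg_closure" and i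
    by (simp add: mult.commute flip: power_mult)
  have root: "poly (map_poly to_ac g) (a ^ 2 ^ i) = 0" for i
  proof (induction i)
    case (Suc i)
    then show ?case unfolding pow_Suc poly_gf2_square by simp
  qed (simp add: a)
  have shift: "a ^ 2 ^ (j - i) = a" if "a ^ 2 ^ i = a ^ 2 ^ j" "i < j" for i j
  proof (rule pow_two_pow_inj[of _ i])
    show "(a ^ 2 ^ (j - i)) ^ 2 ^ i = a ^ 2 ^ i"
      using that by (simp flip: power_mult power_add)
  qed
  have "\<not> inj (\<lambda>i. a ^ 2 ^ i)"
  proof
    assume "inj (\<lambda>i::nat. a ^ 2 ^ i)"
    then have "infinite (range (\<lambda>i::nat. a ^ 2 ^ i))" by (rule range_inj_infinite)
    moreover have "range (\<lambda>i::nat. a ^ 2 ^ i) \<subseteq> {z. poly (map_poly to_ac g) z = 0}"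
      using root by auto
    ultimately show False using poly_roots_finite[OF g0] finite_subset by blast
  qed
  then obtain i j where "i < j" "a ^ 2 ^ i = a ^ 2 ^ j"
    unfolding inj_def by (metis linorder_neqE_nat)
  \<comment> \<open>a repetition in the sequence of iterated squares yields a period, as squaring is injective\<close>
  then have ex: "\<exists>d>0. a ^ 2 ^ d = a" using shift by (metis zero_less_diff)
  define d where "d = (LEAST d. d > 0 \<and> a ^ 2 ^ d = a)"
  have d: "d > 0" "a ^ 2 ^ d = a" using LeastI_ex[OF ex] by (auto simp: d_def)
  define zs where "zs = map (\<lambda>i. a ^ 2 ^ i) [0..<d]"
  have "inj_on (\<lambda>i. a ^ 2 ^ i) {0..<d}"
  proof (rule linorder_inj_onI)
    fix i j assume "i < j" "i \<in> {0..<d}" "j \<in> {0..<d}"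
    then have "j - i > 0" "j - i < d" by auto
    then show "a ^ 2 ^ i \<noteq> a ^ 2 ^ j"
      using shift[of i j] \<open>i < j\<close> not_less_Least[of "j - i" "\<lambda>d. d > 0 \<and> a ^ 2 ^ d = a"]
      by (auto simp: d_def)
  qed auto
  then have dist: "distinct zs" by (simp add: zs_def distinct_map)
  have sub: "set zs \<subseteq> {z. poly (map_poly to_ac g) z = 0}" using root by (auto simp: zs_def)
  have "map (\<lambda>z. z^2) zs = map (\<lambda>i. a ^ 2 ^ i) [1..<Suc d]"
    unfolding zs_def by (rule map_square_orbit)
  also have "mset \<dots> = mset zs"
  proof -
    have "map (\<lambda>i. a ^ 2 ^ i) [1..<Suc d] = map (\<lambda>i. a ^ 2 ^ i) [1..<d] @ [a]"
      using d by simp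
    moreover have "zs = a # map (\<lambda>i. a ^ 2 ^ i) [1..<d]"
      unfolding zs_def using d(1) by (simp add: upt_conv_Cons)
    ultimately show ?thesis by simp
  qed
  finally have perm: "mset (map (\<lambda>z. z^2) zs) = mset zs" .
  interpret sq: comm_ring_hom "\<lambda>z :: gf2 alg_closure. z^2"
    by unfold_locales (simp_all add: square_add power_mult_distrib)
  interpret sq_poly: map_poly_comm_ring_hom "\<lambda>z :: gf2 alg_closure. z^2" ..
  have "map_poly (\<lambda>z. z^2) (roots_poly ys) = roots_poly (map (\<lambda>z. z^2) ys)" for ys :: "gf2 alg_closure list"
    by (induction ys)
      (simp_all add: sq_poly.hom_mult sq.map_poly_pCons_hom minus_eq_self del: mult_pCons_left)
  with perm have sq_fixed: "map_poly (\<lambda>z. z^2) (roots_poly zs) = roots_poly zs"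
    using roots_poly_mset_cong by metis
  define h where "h = map_poly of_ac (roots_poly zs)"
  have h: "map_poly to_ac h = roots_poly zs"
  proof (rule poly_eqI)
    fix i
    have "(coeff (roots_poly zs) i)^2 = coeff (roots_poly zs) i"
      using sq_fixed by (metis coeff_map_poly sq.hom_zero)
    then show "coeff (map_poly to_ac h) i = coeff (roots_poly zs) i"
      unfolding h_def by (simp add: coeff_map_poly to_ac_of_ac sq_eq_self_imp_range_to_ac)
  qed
  have "a \<in> set zs" unfolding zs_def using d(1) by force
  then have "poly (map_poly to_ac h) a = 0"
    by (auto simp: h poly_roots_poly prod_list_zero_iff)
  then have "g dvd h" using irreducible_dvd_of_common_root assms a by blast
  then have dvd: "map_poly to_ac g dvd roots_poly zs"
    using h to_ac_poly_hom.hom_dvd by metis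
  have "roots_poly zs \<noteq> 0" by (auto simp: roots_poly_def prod_list_zero_iff)
  then have "degree g \<le> d"
    using dvd_imp_degree_le[OF dvd] by (simp add: zs_def)
  moreover have "d \<le> degree g"
    using card_mono[OF poly_roots_finite[OF g0] sub] card_poly_roots_bound[OF g0] distinct_card[OF dist]
    by (simp add: zs_def)
  moreover have "{z. poly (map_poly to_ac g) z = 0} \<subseteq> set zs"
  proof
    fix z assume "z \<in> {z. poly (map_poly to_ac g) z = 0}"
    then have "poly (roots_poly zs) z = 0" using dvd by (auto elim!: dvdE)
    then show "z \<in> set zs" by (auto simp: poly_roots_poly prod_list_zero_iff)
  qed
  ultimately show thesis
    using that[of d a] d dist sub unfolding zs_def by (meson order_antisym)
qed

lemma frob_vandermonde: "frob (vandermonde xs) = vandermonde (map frob xs)"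
  by (induction xs) (simp_all add: frob_hom.hom_prod_list hom_distribs o_def frob_hom.hom_mult)

text \<open>
  The function \<open>L\<close> is any way to lift roots that is compatible with Frobenius.  Two instances are needed:
  the lift with vanishing higher components, and the lift to roots of an integer polynomial.  A further irreducible
  factor contributes the sign of a cycle, while the differences between its roots and the other
  roots are only permuted.
\<close>

lemma frob_vandermonde_roots:
  fixes f :: "gf2 poly" and L :: "gf2 alg_closure \<Rightarrow> gf2 alg_closure witt3"
  assumes "f \<noteq> 0" "squarefree f"
    and "\<And>z. poly (map_poly to_ac f) z = 0 \<Longrightarrow> frob (L z) = L (z^2)"
  shows "\<exists>zs. distinct zs \<and> set zs = {z. poly (map_poly to_ac f) z = 0} \<and> length zs = degree f \<and>
    frob (vandermonde (map L zs)) = (-1) ^ (degree f + size (prime_factorization f)) * vandermonde (map L zs)"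
  using assms
proof (induction f rule: prime_divisors_induct)
  case (unit f)
  then have deg: "degree f = 0" by (simp add: is_unit_iff_degree)
  then obtain c where "f = [:c:]" "c \<noteq> 0" using unit by (auto elim: degree_eq_zeroE)
  then show ?case using unit deg
    by (intro exI[of _ "[]"]) (simp add: prime_factorization_unit)
next
  case (factor p f)
  have irr: "irreducible p" using factor.hyps by (simp add: prime_elem_imp_irreducible prime_def)
  have nz: "p \<noteq> 0" "f \<noteq> 0" using factor.prems(1) by auto
  have root_iff: "poly (map_poly to_ac (p * f)) z = 0 \<longleftrightarrow>
      poly (map_poly to_ac p) z = 0 \<or> poly (map_poly to_ac f) z = 0" for z
    by (simp add: hom_distribs)
  obtain ys where ys: "distinct ys" "set ys = {z. poly (map_poly to_ac f) z = 0}"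
    "length ys = degree f"
    "frob (vandermonde (map L ys)) = (-1) ^ (degree f + size (prime_factorization f)) * vandermonde (map L ys)"
    using factor.IH factor.prems root_iff nz squarefree_multD(2) by meson
  obtain a d where ad: "degree p = d" "d > 0" "a ^ 2 ^ d = a"
    "distinct (map (\<lambda>i. a ^ 2 ^ i) [0..<d])"
    "set (map (\<lambda>i. a ^ 2 ^ i) [0..<d]) = {z. poly (map_poly to_ac p) z = 0}"
    using irreducible_roots_frobenius_orbit[OF irr] by metis
  define xs where "xs = map (\<lambda>i. a ^ 2 ^ i) [0..<d]"
  have xs: "distinct xs" "set xs = {z. poly (map_poly to_ac p) z = 0}" "length xs = degree p"
    using ad by (simp_all add: xs_def)
  have disj: "set xs \<inter> set ys = {}"
  proof (rule ccontr)
    assume "set xs \<inter> set ys \<noteq> {}"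
    then obtain z where "poly (map_poly to_ac p) z = 0" "poly (map_poly to_ac f) z = 0"
      using xs(2) ys(2) by auto
    then have "p dvd f" by (rule irreducible_dvd_of_common_root[OF irr])
    then have "p^2 dvd p * f" by (simp add: power2_eq_square)
    then show False
      using factor.prems(2) irr unfolding squarefree_def by (auto dest: irreducible_not_unit)
  qed
  have frob_L: "map frob (map L us) = map L (map (\<lambda>z. z^2) us)"
    if "\<forall>z\<in>set us. poly (map_poly to_ac (p * f)) z = 0" for us
    using that factor.prems(3) by simp
  have frob_xs: "frob (vandermonde (map L xs)) = (-1) ^ (degree p + 1) * vandermonde (map L xs)"
  proof -
    have hd: "xs = a # map (\<lambda>i. a ^ 2 ^ i) [1..<d]"
      unfolding xs_def using ad(2) by (simp add: upt_conv_Cons)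
    have "map (\<lambda>z. z^2) xs = map (\<lambda>i. a ^ 2 ^ i) [1..<Suc d]"
      unfolding xs_def by (rule map_square_orbit)
    also have "\<dots> = map (\<lambda>i. a ^ 2 ^ i) [1..<d] @ [a]"
      using ad(2,3) by simp
    finally have sq: "map (\<lambda>z. z^2) xs = map (\<lambda>i. a ^ 2 ^ i) [1..<d] @ [a]" .
    have "frob (vandermonde (map L xs)) = vandermonde (map L (map (\<lambda>z. z^2) xs))"
      unfolding frob_vandermonde by (subst frob_L) (simp_all add: xs(2) root_iff)
    also have "\<dots> = (-1) ^ (d - 1) * vandermonde (map L xs)"
      unfolding sq map_append list.map(1,2) vandermonde_rotate by (subst hd) simp
    also have "(-1) ^ (d - 1) = ((-1) ^ (degree p + 1) :: gf2 alg_closure witt3)"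
      using ad(1,2) by (cases d) simp_all
    finally show ?thesis .
  qed
  have sq_bij: "bij_betw (\<lambda>z. z^2) (set us) (set us)"
    if "set us = {z. poly (map_poly to_ac q) z = 0}" for us and q :: "gf2 poly"
  proof -
    have inj: "inj_on (\<lambda>z. z^2) (set us)" by (rule inj_onI, rule sq_inj)
    moreover have "(\<lambda>z. z^2) ` set us \<subseteq> set us"
      unfolding that by (auto simp: poly_gf2_square)
    ultimately show ?thesis
      by (simp add: bij_betw_def endo_inj_surj)
  qed
  have cross_eq: "(\<Prod>x\<leftarrow>map L xs. \<Prod>y\<leftarrow>map L ys. x - y) = (\<Prod>x\<in>set xs. \<Prod>y\<in>set ys. L x - L y)"
    using xs(1) ys(1) by (simp add: prod.distinct_set_conv_list o_def)
  have "frob (\<Prod>x\<in>set xs. \<Prod>y\<in>set ys. L x - L y) = (\<Prod>x\<in>set xs. \<Prod>y\<in>set ys. L (x^2) - L (y^2))"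
    unfolding frob_hom.hom_prod
    using factor.prems(3) xs(2) ys(2) root_iff by (intro prod.cong refl) (auto simp: frob_hom.hom_minus)
  also have "\<dots> = (\<Prod>x\<in>set xs. \<Prod>y\<in>set ys. L x - L y)"
    using prod.reindex_bij_betw[OF sq_bij[OF xs(2)], of "\<lambda>x. \<Prod>y\<in>set ys. L x - L y"]
      prod.reindex_bij_betw[OF sq_bij[OF ys(2)], of "\<lambda>y. L _ - L y"]
    by simp
  finally have cross: "frob (\<Prod>x\<leftarrow>map L xs. \<Prod>y\<leftarrow>map L ys. x - y) = (\<Prod>x\<leftarrow>map L xs. \<Prod>y\<leftarrow>map L ys. x - y)"
    unfolding cross_eq .
  have deg: "degree (p * f) = degree p + degree f" using nz by (rule degree_mult_eq)
  have size: "size (prime_factorization (p * f)) = Suc (size (prime_factorization f))"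
    using nz factor.hyps by (simp add: prime_factorization_mult prime_factorization_prime)
  show ?case
  proof (intro exI conjI)
    show "distinct (xs @ ys)" using xs(1) ys(1) disj by simp
    show "set (xs @ ys) = {z. poly (map_poly to_ac (p * f)) z = 0}"
      unfolding root_iff using xs(2) ys(2) by auto
    show "length (xs @ ys) = degree (p * f)" using xs(3) ys(3) deg by simp
    show "frob (vandermonde (map L (xs @ ys))) =
        (-1) ^ (degree (p * f) + size (prime_factorization (p * f))) * vandermonde (map L (xs @ ys))"
      unfolding map_append vandermonde_append frob_hom.hom_mult cross ys(4) frob_xs deg size
      by (simp add: power_add mult_ac)
  qed
qed simp

section \<open>The criterion of Stickelberger and Swan\<close>

lemma vandermonde_eq_0_iff: "vandermonde xs = 0 \<longleftrightarrow> \<not> distinct (xs :: 'a::idom list)"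
  by (induction xs) (auto simp: prod_list_zero_iff)

lemma formal_deriv_roots_neq_0:
  fixes xs :: "'a::idom list"
  assumes "distinct xs" "x \<in> set xs"
  shows "poly (formal_deriv (roots_poly xs)) x \<noteq> 0"
proof
  assume "poly (formal_deriv (roots_poly xs)) x = 0"
  then have "(\<Prod>x\<leftarrow>xs. poly (formal_deriv (roots_poly xs)) x) = 0"
    using assms(2) by (auto simp: prod_list_zero_iff)
  then show False
    unfolding prod_formal_deriv_roots using assms(1) by (simp add: vandermonde_eq_0_iff)
qed

lemma w0_vandermonde: "w0 (vandermonde xs) = vandermonde (map w0 xs)"
  by (induction xs) (simp_all add: w0_hom.hom_prod_list o_def)

lemma witt3_four_neq_0: "(4 :: 'a::{char_two_ring, alg_closed_field} witt3) \<noteq> 0"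
  using four_mult_eq_0_iff[of "1 :: 'a witt3"] by simp

text \<open>
  With \<open>V = 1 + 2 u\<close> the square of \<open>V\<close> is \<open>1 + 4 (u^2 + u)\<close>.  The residue of \<open>u^2 + u\<close> is known because
  Frobenius acts on residues by squaring: \<open>frob V = V\<close> means that \<open>frob u - u\<close> has residue 0, and
  \<open>frob V = - V\<close> means that \<open>frob u + u + 1\<close> has residue 0.
\<close>

lemma square_of_frob_eigen:
  fixes V :: "'a::{char_two_ring, alg_closed_field} witt3"
  assumes "w0 V = 1" "frob V = (-1) ^ k * V"
  shows "V^2 = (if even k then 1 else 5)"
proof -
  have "w0 (V - 1) = 0" using assms(1) by simp
  then obtain u where "V - 1 = 2 * u" by (rule w0_eq_0_imp_even)
  then have V: "V = 1 + 2 * u" by (simp add: algebra_simps)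
  have sq: "V^2 = 1 + 4 * (u^2 + u)"
    unfolding V by (simp add: power2_eq_square algebra_simps)
  have fV: "frob V = 1 + 2 * frob u"
    unfolding V by (simp add: frob_hom.hom_add frob_hom.hom_mult frob_hom.hom_numeral)
  show ?thesis
  proof (cases "even k")
    case True
    then have "2 * (frob u - u) = 0" using assms(2) fV by (simp add: V algebra_simps)
    then have "w0 (frob u - u) = 0" by (rule two_mult_eq_0_imp)
    then have "w0 (u^2 + u) = 0" by (simp add: diff_eq_plus power2_eq_square)
    then have "4 * (u^2 + u) = 0" by (simp only: four_mult_eq_0_iff)
    then show ?thesis using True sq by simp
  next
    case False
    then have "2 * (frob u + u + 1) = 0" using assms(2) fV by (simp add: V algebra_simps)
    then have "w0 (frob u + u + 1) = 0" by (rule two_mult_eq_0_imp)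
    then have "w0 (u^2 + u + 1) = 0" by (simp add: power2_eq_square)
    then have "4 * (u^2 + u + 1) = 0" by (simp only: four_mult_eq_0_iff)
    moreover have "4 * (u^2 + u) = 4 * (u^2 + u + 1) + 4 - 8" by (simp add: algebra_simps)
    ultimately have "4 * (u^2 + u) = 4" by (simp add: witt3_eight)
    then show ?thesis using False sq by simp
  qed
qed

text \<open>
  The discriminant of an integer polynomial modulo 8 determines the parity of the number of factors of
  its reduction modulo 2.
\<close>

theorem stickelberger_swan:
  fixes p :: "int poly" and f :: "gf2 poly"
  assumes "lead_coeff p = 1" and f: "f = map_poly of_int p" and "squarefree f"
  obtains xs :: "gf2 alg_closure witt3 list" where
    "map_poly of_int p = roots_poly xs" "length xs = degree p"
    "(vandermonde xs)^2 = (if even (degree p + size (prime_factorization f)) then 1 else 5)"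
proof -
  define P :: "gf2 alg_closure witt3 poly" where "P = map_poly of_int p"
  define Q where "Q = map_poly to_ac f"
  have deg: "degree P = degree p" "lead_coeff P = 1"
    and degf: "degree f = degree p" "lead_coeff f = 1"
    using assms(1) by (simp_all add: P_def f coeff_map_poly map_poly_degree_eq)
  have degQ: "degree Q = degree p" "lead_coeff Q = 1"
    using degf by (simp_all add: Q_def)
  have f0: "f \<noteq> 0" using degf(2) by auto
  have w0_P: "map_poly w0 P = Q"
    by (rule poly_eqI) (simp add: P_def Q_def f coeff_map_poly w0_hom.hom_of_int)
  have frob_P: "map_poly frob P = P"
    by (rule poly_eqI) (simp add: P_def coeff_map_poly frob_hom.hom_of_int)
  \<comment> \<open>the lift with vanishing higher components already shows that \<open>f\<close> has as many roots as its degree\<close>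
  obtain zs where zs: "distinct zs" "set zs = {z. poly Q z = 0}" "length zs = degree f"
    using frob_vandermonde_roots[OF f0 \<open>squarefree f\<close>, of "\<lambda>z. Witt z 0 0"] unfolding Q_def by auto
  have Q: "Q = roots_poly zs"
    using zs degQ degf(1) by (intro eq_roots_polyI) auto
  have simple: "w0 (poly (formal_deriv P) b) \<noteq> 0" if "poly Q (w0 b) = 0" for b
  proof -
    have "w0 (poly (formal_deriv P) b) = poly (formal_deriv Q) (w0 b)"
      using poly_formal_deriv_map[OF w0_hom.comm_ring_hom_axioms, of P b] by (simp only: w0_P)
    then show ?thesis using formal_deriv_roots_neq_0[OF zs(1)] zs(2) that Q by auto
  qed
  define L where "L z = (SOME b. w0 b = z \<and> poly P b = 0)" for z
  have L: "w0 (L z) = z \<and> poly P (L z) = 0" if "poly Q z = 0" for z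
  proof -
    have "w0 (poly P (Witt z 0 0)) = 0"
      using that unfolding w0_P[symmetric] by (metis w0_hom.poly_map_poly witt3.sel(1))
    moreover have "w0 (poly (formal_deriv P) (Witt z 0 0)) \<noteq> 0"
      using simple that by simp
    ultimately obtain b where "w0 b = w0 (Witt z 0 0)" "poly P b = 0"
      by (rule hensel_lift)
    then have "\<exists>b. w0 b = z \<and> poly P b = 0" by auto
    then show ?thesis unfolding L_def by (rule someI_ex)
  qed
  have frob_L: "frob (L z) = L (z^2)" if z: "poly Q z = 0" for z
  proof -
    have z2: "poly Q (z^2) = 0" using z by (simp add: Q_def poly_gf2_square)
    have "poly P (frob (L z)) = 0"
      using L[OF z] by (metis frob_P frob_hom.hom_zero frob_hom.poly_map_poly)
    then show ?thesis
    proof (rule hensel_unique)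
      show "poly P (L (z^2)) = 0" using L[OF z2] by blast
      show w0_eq: "w0 (frob (L z)) = w0 (L (z^2))" unfolding w0_frob using L[OF z] L[OF z2] by metis
      show "w0 (poly (formal_deriv P) (frob (L z))) \<noteq> 0"
      proof (rule simple)
        show "poly Q (w0 (frob (L z))) = 0" unfolding w0_eq using L[OF z2] z2 by metis
      qed
    qed
  qed
  obtain ys where ys: "distinct ys" "set ys = {z. poly Q z = 0}" "length ys = degree f"
    "frob (vandermonde (map L ys)) = (-1) ^ (degree f + size (prime_factorization f)) * vandermonde (map L ys)"
    using frob_vandermonde_roots[OF f0 \<open>squarefree f\<close>, of L] frob_L unfolding Q_def by auto
  have w0_L: "map w0 (map L ys) = ys"
    unfolding list.map_comp using L ys(2) by (intro map_idI) auto
  have P: "P = roots_poly (map L ys)"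
  proof (rule eq_roots_polyI)
    show "degree P = length (map L ys)" using deg degf ys(3) by simp
    show "distinct (map L ys)" using ys(1) w0_L by (metis distinct_map)
    show "c = 0" if xy: "x \<in> set (map L ys)" "y \<in> set (map L ys)" "x \<noteq> y" and "(x - y) * c = 0"
      for x y c
    proof -
      have "w0 (x - y) \<noteq> 0" using xy L ys(2) by auto
      then obtain d where "(x - y) * d = 1" by (rule witt3_unit)
      then have "c = (x - y) * c * d" by (simp add: mult.commute mult.left_commute)
      then show ?thesis using that(4) by simp
    qed
    show "poly P x = 0" if "x \<in> set (map L ys)" for x using that L ys(2) by auto
  qed (rule deg(2))
  define V where "V = vandermonde (map L ys)"
  \<comment> \<open>the residue of \<open>V\<close> is nonzero and idempotent, as signs disappear in characteristic two\<close>
  have "w0 V \<noteq> 0" unfolding V_def w0_vandermonde w0_L vandermonde_eq_0_iff using ys(1) by simp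
  moreover have "(w0 V)^2 = w0 V"
  proof -
    have "(w0 V)^2 = w0 (frob V)" by simp
    also have "\<dots> = (- 1) ^ (degree f + size (prime_factorization f)) * w0 V"
      unfolding V_def ys(4) by (simp add: w0_hom.hom_power)
    finally show ?thesis by (simp add: minus_eq_self)
  qed
  ultimately have "w0 V = 1" by (simp add: power2_eq_square)
  then have "V^2 = (if even (degree f + size (prime_factorization f)) then 1 else 5)"
    using ys(4) unfolding V_def by (rule square_of_frob_eigen)
  then show thesis
    using that[of "map L ys"] P ys(3) degf(1) unfolding V_def P_def by simp
qed

section \<open>Products modulo 8 and power sums of inverse roots\<close>

text \<open>
  Expanding gives \<open>1 - 2 e\<^sub>1 + 4 e\<^sub>2\<close> in the elementary symmetric functions, and \<open>2 e\<^sub>2\<close> is the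
  square of the sum minus the sum of the squares.  The induction also carries the existence of
  \<open>e\<^sub>2\<close>, since division by 2 is not possible.
\<close>

lemma prod_one_minus_two_mult:
  fixes ys :: "'a::comm_ring_1 list"
  assumes "(8 :: 'a) = 0"
  shows "(\<Prod>y\<leftarrow>ys. 1 - 2 * y) =
    1 - 2 * (\<Sum>y\<leftarrow>ys. y) + 2 * (\<Sum>y\<leftarrow>ys. y)^2 - 2 * (\<Sum>y\<leftarrow>ys. y^2)"
proof -
  have "(\<exists>e. (\<Sum>y\<leftarrow>ys. y)^2 - (\<Sum>y\<leftarrow>ys. y^2) = 2 * e) \<and> ?thesis"
  proof (induction ys)
    case (Cons y ys)
    define s t where "s = (\<Sum>y\<leftarrow>ys. y)" and "t = (\<Sum>y\<leftarrow>ys. y^2)"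
    obtain e where e: "s^2 - t = 2 * e"
      using Cons.IH[THEN conjunct1] unfolding s_def t_def by (elim exE)
    have IH: "(\<Prod>y\<leftarrow>ys. 1 - 2 * y) = 1 - 2 * s + 2 * s^2 - 2 * t"
      using Cons.IH[THEN conjunct2] unfolding s_def t_def .
    have y_e: "(y + s)^2 - (y^2 + t) = 2 * (e + y * s)"
    proof -
      have "(y + s)^2 - (y^2 + t) = (s^2 - t) + 2 * (y * s)"
        by (simp add: power2_eq_square algebra_simps)
      then show ?thesis by (simp only: e distrib_left)
    qed
    have "(1 - 2 * y) * (1 - 2 * s + 2 * s^2 - 2 * t) =
        1 - 2 * (y + s) + 2 * (y + s)^2 - 2 * (y^2 + t) - 4 * (y * (s^2 - t))"
      by (simp add: power2_eq_square algebra_simps)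
    also have "\<dots> = 1 - 2 * (y + s) + 2 * (y + s)^2 - 2 * (y^2 + t) - 8 * (y * e)"
      unfolding e by (simp add: algebra_simps)
    finally have "(1 - 2 * y) * (1 - 2 * s + 2 * s^2 - 2 * t) =
        1 - 2 * (y + s) + 2 * (y + s)^2 - 2 * (y^2 + t)"
      using assms by simp
    with y_e show ?case
      unfolding list.map prod_list.Cons sum_list.Cons IH s_def[symmetric] t_def[symmetric]
      by (intro conjI exI)
  qed (intro conjI exI[of _ 0]; simp)
  then show ?thesis ..
qed

text \<open>
  Newton's identities in the form of the logarithmic derivative: a single root \<open>x\<close> with inverse \<open>z\<close>
  contributes the geometric series \<open>z X + z^2 X^2 + \<dots>\<close>, whose product with \<open>X - x\<close> is \<open>- X\<close>.
\<close>

lemma fps_power_sums_inverse_roots: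
  fixes xs :: "'a::comm_ring_1 list"
  assumes "\<And>x. x \<in> set xs \<Longrightarrow> x * g x = 1"
  shows "fps_of_poly (roots_poly xs) * Abs_fps (\<lambda>j. if j = 0 then 0 else \<Sum>x\<leftarrow>xs. g x ^ j) =
    - fps_X * fps_of_poly (formal_deriv (roots_poly xs))"
  using assms
proof (induction xs)
  case (Cons a xs)
  define \<sigma> where "\<sigma> ys = Abs_fps (\<lambda>j. if j = 0 then 0 else \<Sum>x\<leftarrow>ys. g x ^ j)" for ys
  define G where "G = fps_of_poly (roots_poly xs)"
  have split: "\<sigma> (a # xs) = \<sigma> [a] + \<sigma> xs"
    by (simp add: \<sigma>_def fps_eq_iff)
  have one: "(fps_X - fps_const a) * \<sigma> [a] = - fps_X"
  proof (rule fps_ext)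
    fix i
    have "a * g a ^ Suc j = g a ^ j" for j
      using Cons.prems[of a] by (simp flip: mult.assoc)
    moreover have "a * g a = 1" using Cons.prems[of a] by simp
    ultimately show "((fps_X - fps_const a) * \<sigma> [a]) $ i = (- fps_X) $ i"
      by (cases i; cases "i - 1")
        (simp_all add: \<sigma>_def left_diff_distrib fps_X_mult_nth fps_mult_left_const_nth del: power_Suc)
  qed
  have lin: "fps_of_poly [:- a, 1:] = fps_X - fps_const a"
    by (simp add: fps_eq_iff coeff_pCons split: nat.split)
  have IH: "G * \<sigma> xs = - fps_X * fps_of_poly (formal_deriv (roots_poly xs))"
    using Cons unfolding G_def \<sigma>_def by simp
  have "fps_of_poly (roots_poly (a # xs)) * \<sigma> (a # xs) =
      G * ((fps_X - fps_const a) * \<sigma> [a]) + (fps_X - fps_const a) * (G * \<sigma> xs)"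
    unfolding roots_poly_simps fps_of_poly_mult lin split G_def by (simp only: algebra_simps)
  also have "\<dots> = - fps_X * (G + (fps_X - fps_const a) * fps_of_poly (formal_deriv (roots_poly xs)))"
    unfolding one IH by (simp only: algebra_simps)
  also have "G + (fps_X - fps_const a) * fps_of_poly (formal_deriv (roots_poly xs)) =
      fps_of_poly (formal_deriv (roots_poly (a # xs)))"
    unfolding roots_poly_simps formal_deriv_linear_mult fps_of_poly_add fps_of_poly_mult lin G_def ..
  finally show ?case unfolding \<sigma>_def .
qed (simp add: fps_eq_iff)

section \<open>The lifted pentanomial and its power sums\<close>

text \<open>
  The signs are chosen such that the polynomial equals \<open>x^m + (x + 1) (x^n - 1)\<close>; on its roots, which are units,
  \<open>(x + 1) (x^n - 1) = - x^m\<close> is then a unit as well.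
\<close>

definition pentanomial_lift :: "nat \<Rightarrow> nat \<Rightarrow> 'a::comm_ring_1 poly" where
  "pentanomial_lift m n = monom 1 m + monom 1 (n + 1) + monom 1 n - monom 1 1 - 1"

text \<open>
  The first two summands are the power sums for \<open>(x + 1) (x^n - 1)\<close> alone.  The last one
  is the first-order effect of \<open>x^m\<close>; its second-order effect begins at exponent \<open>2 m\<close>.
\<close>

definition inverse_power_sum :: "nat \<Rightarrow> nat \<Rightarrow> nat \<Rightarrow> int" where
  "inverse_power_sum m n j = (-1) ^ j + (if n dvd j then int n else 0) +
     (if m \<le> j then int j * (-1) ^ (j - m) * (int ((j - m) div n) + 1) else 0)"

lemma fps_of_poly_formal_deriv: "fps_of_poly (formal_deriv p) = fps_deriv (fps_of_poly p)"
  by (simp add: fps_eq_iff coeff_formal_deriv)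

lemma fps_X_deriv_power: "fps_X * fps_deriv (fps_X ^ n) = (of_nat n * fps_X ^ n :: 'a::comm_ring_1 fps)"
proof (induction n)
  case (Suc n)
  have "fps_X * fps_deriv (fps_X ^ Suc n :: 'a fps) =
      fps_X * (fps_X * fps_deriv (fps_X ^ n)) + fps_X * fps_X ^ n"
    unfolding power_Suc fps_deriv_mult fps_deriv_fps_X by (simp only: algebra_simps mult_1_left)
  then show ?case
    unfolding Suc.IH by (simp add: algebra_simps)
qed simp

text \<open>
  With \<open>U = (1 + X) (1 - X^n)\<close> the lifted pentanomial is \<open>X^m - U\<close>, and the first-order
  expansion of its logarithmic derivative in powers of \<open>X^m\<close> is \<open>A + C\<close>, where \<open>A\<close> belongs to \<open>U\<close> and \<open>C\<close> is
  \<open>X\<close> times the derivative of \<open>X^m / U\<close>.  The series \<open>W\<close> is the inverse of \<open>U\<close>; its \<open>i\<close>-th coefficient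
  counts the multiples of \<open>n\<close> up to \<open>i\<close>, with sign.
\<close>

lemma power_sums_inverse_roots_pentanomial:
  fixes xs :: "'a::comm_ring_1 list"
  assumes "roots_poly xs = pentanomial_lift m n" and g: "\<And>x. x \<in> set xs \<Longrightarrow> x * g x = 1"
    and "even n" "n > 0" "j > 0" "j < 2 * m"
  shows "(\<Sum>x\<leftarrow>xs. g x ^ j) = of_int (inverse_power_sum m n j)"
proof -
  define U W a1 a2 :: "'a fps" where "U = (1 + fps_X) * (1 - fps_X ^ n)"
    and "W = Abs_fps (\<lambda>i. (-1) ^ i * of_nat (i div n + 1))"
    and "a1 = Abs_fps (\<lambda>i. (-1) ^ i)"
    and "a2 = Abs_fps (\<lambda>i. if n dvd i then 1 else 0)"
  have a1: "(1 + fps_X) * a1 = 1"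
  proof (rule fps_ext)
    fix i show "((1 + fps_X) * a1) $ i = 1 $ i"
      by (cases i) (simp_all add: a1_def distrib_right)
  qed
  have a2: "(1 - fps_X ^ n) * a2 = 1"
    using \<open>n > 0\<close>
    by (intro fps_ext) (auto simp: a2_def left_diff_distrib fps_X_power_mult_nth dvd_minus_self dest: dvd_imp_le)
  have W_a1: "(1 - fps_X ^ n) * W = a1"
  proof (rule fps_ext)
    fix i
    show "((1 - fps_X ^ n) * W) $ i = a1 $ i"
    proof (cases "i < n")
      case False
      then have "(-1) ^ i = ((-1) ^ (i - n) * (-1) ^ n :: 'a)"
        by (simp flip: power_add)
      then have "(-1) ^ (i - n) = ((-1) ^ i :: 'a)"
        using \<open>even n\<close> by simp
      moreover have "i div n = Suc ((i - n) div n)"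
        using False \<open>n > 0\<close> by (simp add: le_div_geq)
      ultimately show ?thesis
        using False by (simp add: W_def a1_def left_diff_distrib fps_X_power_mult_nth algebra_simps)
    qed (simp add: W_def a1_def left_diff_distrib fps_X_power_mult_nth)
  qed
  have UW: "U * W = 1"
    unfolding U_def mult.assoc W_a1 a1 ..
  define A where "A = - fps_X * a1 + of_nat n * fps_X ^ n * a2"
  define U' where "U' = fps_X * fps_deriv U"
  have "U' = (1 + fps_X) * - (fps_X * fps_deriv (fps_X ^ n)) + fps_X * (1 - fps_X ^ n)"
    unfolding U'_def U_def by (simp add: algebra_simps)
  then have U': "U' = fps_X * (1 - fps_X ^ n) - of_nat n * fps_X ^ n * (1 + fps_X)"
    unfolding fps_X_deriv_power by (simp add: algebra_simps)
  have "U * A = - fps_X * (1 - fps_X ^ n) * ((1 + fps_X) * a1)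
      + of_nat n * fps_X ^ n * (1 + fps_X) * ((1 - fps_X ^ n) * a2)"
    unfolding U_def A_def by (simp only: algebra_simps)
  then have UA: "U * A = - U'"
    unfolding a1 a2 U' by simp
  define C where "C = fps_X * fps_deriv (fps_X ^ m * W)"
  define D where "D = of_nat m * W + fps_X * fps_deriv W"
  have "C = (fps_X * fps_deriv (fps_X ^ m)) * W + fps_X ^ m * (fps_X * fps_deriv W)"
    unfolding C_def fps_deriv_mult by (simp only: algebra_simps)
  then have C: "C = fps_X ^ m * D"
    unfolding fps_X_deriv_power D_def by (simp add: algebra_simps)
  have "U * fps_deriv W + fps_deriv U * W = 0"
    using arg_cong[OF UW, of fps_deriv] by simp
  then have "U * fps_deriv W = - (fps_deriv U * W)"
    by (simp only: eq_neg_iff_add_eq_0)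
  then have "U * (fps_X * fps_deriv W) = - (U' * W)"
    unfolding U'_def mult.left_commute[of U fps_X] by (simp add: mult.assoc)
  also have "\<dots> = U * A * W" unfolding UA by simp
  also have "\<dots> = A * (U * W)" by (simp only: mult_ac)
  also have "\<dots> = A" by (simp add: UW)
  finally have UW': "U * (fps_X * fps_deriv W) = A" .
  have "U * D = of_nat m * (U * W) + U * (fps_X * fps_deriv W)"
    unfolding D_def by (simp only: algebra_simps)
  then have UD: "U * D = of_nat m + A"
    unfolding UW UW' by simp
  then have UC: "U * C = of_nat m * fps_X ^ m + fps_X ^ m * A"
    unfolding C mult.left_commute[of U] UD by (simp add: distrib_left mult.commute)
  have F: "fps_of_poly (pentanomial_lift m n) = fps_X ^ m - U"
    unfolding pentanomial_lift_def U_def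
    by (simp add: fps_of_poly_add fps_of_poly_diff fps_of_poly_monom algebra_simps)
  define \<sigma> where "\<sigma> = Abs_fps (\<lambda>j. if j = 0 then 0 else \<Sum>x\<leftarrow>xs. g x ^ j)"
  have \<sigma>: "(fps_X ^ m - U) * \<sigma> = - (fps_X * fps_deriv (fps_X ^ m - U))"
    using fps_power_sums_inverse_roots[of xs g] g
    unfolding \<sigma>_def fps_of_poly_formal_deriv assms(1) F by simp
  define \<delta> where "\<delta> = \<sigma> - (A + C)"
  have F': "fps_X * fps_deriv (fps_X ^ m - U) = of_nat m * fps_X ^ m - U'"
    unfolding U'_def by (simp add: right_diff_distrib fps_X_deriv_power)
  have "(fps_X ^ m - U) * \<delta> = - (of_nat m * fps_X ^ m - U')
      - (fps_X ^ m * A + fps_X ^ m * C - U * A - U * C)"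
    unfolding \<delta>_def right_diff_distrib \<sigma> F' by (simp only: algebra_simps)
  also have "\<dots> = - (fps_X ^ m * C)"
    unfolding UA UC by (simp add: algebra_simps)
  finally have U\<delta>: "U * \<delta> = fps_X ^ m * (\<delta> + C)"
    by (simp add: algebra_simps)
  have "\<delta> = W * (U * \<delta>)"
    using UW by (simp add: mult.commute[of W] flip: mult.assoc)
  then have \<delta>: "\<delta> = fps_X ^ m * (W * (\<delta> + C))"
    unfolding U\<delta> by (simp only: mult_ac)
  \<comment> \<open>substituting the equation for \<open>\<delta>\<close> into itself raises the order of vanishing from \<open>m\<close> to \<open>2 m\<close>\<close>
  also have "\<dots> = fps_X ^ m * (W * (fps_X ^ m * (W * (\<delta> + C)) + fps_X ^ m * D))"
    using \<delta> C by simp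
  also have "\<dots> = fps_X ^ (2 * m) * (W * (W * (\<delta> + C) + D))"
    unfolding mult_2 power_add by (simp only: algebra_simps)
  finally have "\<delta> $ j = 0"
    using \<open>j < 2 * m\<close> by (metis fps_X_power_mult_nth)
  then have "(\<Sum>x\<leftarrow>xs. g x ^ j) = A $ j + C $ j"
    using \<open>j > 0\<close> by (simp add: \<delta>_def \<sigma>_def)
  also have "A $ j = of_int ((-1) ^ j + (if n dvd j then int n else 0))"
  proof -
    have "(- fps_X * a1) $ j = (-1) ^ j"
      using \<open>j > 0\<close> by (cases j) (simp_all add: a1_def)
    moreover have "(of_nat n * fps_X ^ n * a2) $ j = (if n dvd j then of_nat n else 0)"
      using \<open>j > 0\<close>
      by (auto simp: a2_def mult.assoc fps_X_power_mult_nth dvd_minus_self simp flip: fps_of_nat dest: dvd_imp_le)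
    ultimately show ?thesis unfolding A_def by (simp only: fps_add_nth) simp
  qed
  also have "C $ j = of_int (if m \<le> j then int j * (-1) ^ (j - m) * (int ((j - m) div n) + 1) else 0)"
  proof -
    have "(fps_X * fps_deriv G) $ j = of_nat j * G $ j" for G :: "'a fps"
      using \<open>j > 0\<close> by (cases j) simp_all
    then have "C $ j = of_nat j * (fps_X ^ m * W) $ j" unfolding C_def .
    then show ?thesis by (simp add: W_def fps_X_power_mult_nth algebra_simps)
  qed
  finally show ?thesis by (simp add: inverse_power_sum_def)
qed

section \<open>Evaluation modulo 8\<close>

text \<open>
  For odd \<open>n div 2\<close> this is modulo 2 half the sum of \<open>(1 + z)^4 z^(2 p)\<close> over the inverse roots \<open>z\<close>, where
  \<open>p = m - n - 1\<close>, see \<open>half_trace_cong\<close>.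
\<close>

definition half_trace :: "nat \<Rightarrow> nat \<Rightarrow> nat" where
  "half_trace m n = of_bool (n dvd 2 * m - 2) + of_bool (n dvd 2 * m + 2) + (m - 2) div n + (m + 2) div n"

lemma inverse_power_sum_odd:
  assumes "even n" "odd j" "j < m"
  shows "inverse_power_sum m n j = -1"
  using assms by (auto simp: inverse_power_sum_def elim: dvd_trans)

lemma inverse_power_sum_even:
  assumes "even j" "j < m"
  shows "inverse_power_sum m n j = 1 + int n * of_bool (n dvd j)"
  using assms by (auto simp: inverse_power_sum_def)

lemma inverse_power_sum_even_ge:
  assumes "even j" "even m" "m \<le> j"
  shows "inverse_power_sum m n j = 1 + int n * of_bool (n dvd j) + int j * (int ((j - m) div n) + 1)"
  using assms by (auto simp: inverse_power_sum_def)

text \<open>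
  The binomial coefficients leave modulo 4 only the exponents \<open>2 p\<close>, \<open>2 p + 2\<close> and \<open>2 p + 4\<close>.  The middle one
  is divisible by 4 and so gives a constant; at the other two, which are twice odd numbers, both the divisibility
  by \<open>n\<close> and the count of multiples of \<open>n\<close> appear with the factor 2.
\<close>

lemma half_trace_cong:
  fixes m n p :: nat
  assumes "even m" "even n" "odd (n div 2)" "n > 2" "2 * n + 2 \<le> m" "p = m - n - 1"
  defines "s \<equiv> inverse_power_sum m n"
  shows "4 dvd s (2 * p) + 4 * s (2 * p + 1) + 6 * s (2 * p + 2) + 4 * s (2 * p + 3) + s (2 * p + 4)
    - 2 * int (half_trace m n)"
proof -
  obtain h where n: "n = 2 * h" and "odd h" using assms(2,3) by auto
  have "odd p" using assms(1,2,5,6) by presburger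
  then obtain a where p: "p = 2 * a + 1" by (rule oddE)
  obtain h' where h: "h = 2 * h' + 1" using \<open>odd h\<close> oddE by blast
  define d0 d1 d2 q0 q1 q2 where "d0 = (of_bool (n dvd 2 * p) :: int)"
    and "d1 = (of_bool (n dvd 2 * p + 2) :: int)" and "d2 = (of_bool (n dvd 2 * p + 4) :: int)"
    and "q0 = int ((2 * p - m) div n)" and "q1 = int ((2 * p + 2 - m) div n)"
    and "q2 = int ((2 * p + 4 - m) div n)"
  have "n dvd 2 * m - 2 \<longleftrightarrow> n dvd 2 * p + 2 * n"
    by (rule arg_cong[of _ _ "(dvd) n"]) (use assms in simp)
  then have d0: "of_bool (n dvd 2 * m - 2) = d0" by (simp add: d0_def)
  have "n dvd 2 * m + 2 \<longleftrightarrow> n dvd 2 * p + 4 + 2 * n"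
    by (rule arg_cong[of _ _ "(dvd) n"]) (use assms in simp)
  then have d2: "of_bool (n dvd 2 * m + 2) = d2" by (simp add: d2_def)
  have "(m - 2) div n = (2 * p - m + 2 * n) div n"
    by (rule arg_cong[of _ _ "\<lambda>x. x div n"]) (use assms in simp)
  then have q0: "int ((m - 2) div n) = q0 + 2" using assms(4) by (simp add: q0_def)
  have "(m + 2) div n = (2 * p + 4 - m + 2 * n) div n"
    by (rule arg_cong[of _ _ "\<lambda>x. x div n"]) (use assms in simp)
  then have q2: "int ((m + 2) div n) = q2 + 2" using assms(4) by (simp add: q2_def)
  have s0: "s (2 * p) = 1 + int n * d0 + int (2 * p) * (q0 + 1)"
    unfolding s_def d0_def q0_def using assms by (intro inverse_power_sum_even_ge) auto
  have s1: "s (2 * p + 2) = 1 + int n * d1 + int (2 * p + 2) * (q1 + 1)"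
    unfolding s_def d1_def q1_def using assms by (intro inverse_power_sum_even_ge) auto
  have s2: "s (2 * p + 4) = 1 + int n * d2 + int (2 * p + 4) * (q2 + 1)"
    unfolding s_def d2_def q2_def using assms by (intro inverse_power_sum_even_ge) auto
  have J: "int (half_trace m n) = d0 + d2 + (q0 + 2) + (q2 + 2)"
    unfolding half_trace_def using d0 d2 q0 q2 by simp
  have ints: "int p = 2 * int a + 1" "int n = 4 * int h' + 2"
    unfolding n h p by simp_all
  have "s (2 * p) + 4 * s (2 * p + 1) + 6 * s (2 * p + 2) + 4 * s (2 * p + 3) + s (2 * p + 4)
    - 2 * int (half_trace m n) = 4 * (s (2 * p + 1) + s (2 * p + 3) + h' * d0 + h' * d2 + (6 * h' + 3) * d1
      + a * (q0 + 1) + (a + 1) * (q2 + 1) + 6 * (a + 1) * (q1 + 1) + 1)"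
    unfolding s0 s1 s2 J by (simp add: ints algebra_simps)
  then show ?thesis by (metis dvd_triv_left)
qed

text \<open>
  Here \<open>t1\<close> and \<open>t2\<close> are the sums of \<open>y\<close> and \<open>y^2\<close> over the inverse roots \<open>z\<close>, where
  \<open>y = k (1 + z) + h (1 + z)^2 z^p\<close>.  Modulo 4 the sum \<open>t1\<close> is \<open>K = k (2 k - 1)\<close> and \<open>t2\<close> is
  \<open>k K\<close> plus twice the half trace if \<open>h\<close> is odd.  The remaining terms in \<open>k\<close> are linear modulo 8
  because \<open>k (k - 1)\<close> is even.
\<close>

lemma trace_expression_mod_8:
  fixes m n p :: nat
  assumes "even m" "even n" "n > 2" "2 * n + 2 \<le> m" "p = m - n - 1"
  defines "s \<equiv> inverse_power_sum m n"
  defines "k \<equiv> int (m div 2)" and "h \<equiv> int (n div 2)"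
  defines "t1 \<equiv> k * (int m + s 1) + h * (s p + 2 * s (p + 1) + s (p + 2))"
  defines "t2 \<equiv> k^2 * (int m + 2 * s 1 + s 2)
    + 2 * k * h * (s p + 3 * s (p + 1) + 3 * s (p + 2) + s (p + 3))
    + h^2 * (s (2 * p) + 4 * s (2 * p + 1) + 6 * s (2 * p + 2) + 4 * s (2 * p + 3) + s (2 * p + 4))"
  shows "8 dvd (1 - 2 * t1 + 2 * t1^2 - 2 * t2) - (1 - 2 * k - 4 * (if odd h then int (half_trace m n) else 0))"
proof -
  define J where "J = (if odd h then int (half_trace m n) else 0)"
  have m: "int m = 2 * k" and n: "int n = 2 * h"
    unfolding k_def h_def using assms(1,2)
    by (metis even_two_times_div_two of_nat_mult of_nat_numeral)+
  have odd_p: "odd p" using assms(1-5) by simp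
  define e e' :: int where "e = of_bool (n dvd p + 1)" and "e' = of_bool (n dvd p + 3)"
  have s: "s 1 = -1" "s 2 = 1" "s p = -1" "s (p + 1) = 1 + 2 * h * e" "s (p + 2) = -1"
    "s (p + 3) = 1 + 2 * h * e'"
    unfolding s_def e_def e'_def n[symmetric] using assms(1-5) odd_p
    by (auto simp: inverse_power_sum_odd inverse_power_sum_even dest: dvd_imp_le)
  define Z where "Z = s (2 * p) + 4 * s (2 * p + 1) + 6 * s (2 * p + 2) + 4 * s (2 * p + 3) + s (2 * p + 4)"
  have "\<exists>b. h^2 * Z = 2 * J + 4 * b"
  proof (cases "odd h")
    case True
    then have "4 dvd Z - 2 * int (half_trace m n)"
      unfolding Z_def s_def using half_trace_cong[OF assms(1,2) _ assms(3,4,5)] by (simp add: h_def)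
    then obtain c where "Z = 2 * J + 4 * c"
      unfolding J_def using True by (metis diff_eq_eq dvdE add.commute)
    moreover obtain h' where "h = 2 * h' + 1" using True oddE by blast
    ultimately have "h^2 * Z = 2 * J + 4 * ((2 * h' + 1)^2 * c + 2 * J * (h'^2 + h'))"
      by (simp add: power2_eq_square algebra_simps)
    then show ?thesis by blast
  next
    case False
    then obtain h' where "h = 2 * h'" by auto
    then have "h^2 * Z = 2 * J + 4 * (h'^2 * Z)" using False by (simp add: J_def power2_eq_square)
    then show ?thesis by blast
  qed
  then obtain b where b: "h^2 * Z = 2 * J + 4 * b" ..
  define K where "K = k * (2 * k - 1)"
  have t1: "t1 = K + 4 * (h^2 * e)"
    unfolding t1_def s m K_def by (simp add: power2_eq_square algebra_simps)
  have "t2 = k^2 * (2 * k - 1) + 4 * (k * h^2 * (3 * e + e')) + h^2 * Z"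
    unfolding t2_def Z_def[symmetric] unfolding s m by (simp add: power2_eq_square algebra_simps)
  then have t2: "t2 = k * K + 2 * J + 4 * (k * h^2 * (3 * e + e') + b)"
    unfolding b K_def by (simp add: power2_eq_square algebra_simps)
  have "even (k * (k - 1))" by simp
  then obtain c where c: "k * (k - 1) = 2 * c" by (rule evenE)
  define x y where "x = h^2 * e" and "y = k * h^2 * (3 * e + e') + b"
  have "(1 - 2 * t1 + 2 * t1^2 - 2 * t2) - (1 - 2 * k - 4 * J) =
      2 * k - 2 * K + 2 * K * (K - k) + 8 * (- x + 2 * K * x + 4 * x^2 - y)"
    unfolding t1 t2 x_def[symmetric] y_def[symmetric] by (simp add: power2_eq_square algebra_simps)
  also have "2 * k - 2 * K = - 4 * (k * (k - 1))" unfolding K_def by (simp add: algebra_simps)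
  also have "2 * K * (K - k) = 4 * (2 * k - 1) * k * (k * (k - 1))"
    unfolding K_def by (simp add: algebra_simps)
  finally have "(1 - 2 * t1 + 2 * t1^2 - 2 * t2) - (1 - 2 * k - 4 * J) =
      8 * (- c + (2 * k - 1) * k * c + (- x + 2 * K * x + 4 * x^2 - y))"
    unfolding c by (simp add: algebra_simps)
  then show ?thesis unfolding J_def by (metis dvd_triv_left)
qed

text \<open>
  With \<open>a = k div 2\<close> the left-hand side is \<open>1 - 4 (a + J)\<close> for even \<open>k\<close> and \<open>1 + 4 (a + J)\<close> for odd \<open>k\<close>.
\<close>

lemma signed_discriminant_mod_8:
  fixes k J :: int
  shows "(if even k then 1 - 2 * k - 4 * J else - (1 - 2 * k - 4 * J)) mod 8 =
    (if (k mod 4 = 0 \<or> k mod 4 = 1) \<longleftrightarrow> even J then 1 else 5)"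
proof -
  define a where "a = k div 2"
  define e where "e = (if even k then - (a + J) else a + J)"
  have k: "k = 2 * a + (if even k then 0 else 1)"
    unfolding a_def by simp
  have D: "(if even k then 1 - 2 * k - 4 * J else - (1 - 2 * k - 4 * J)) = 1 + 4 * e"
    using k unfolding e_def by (auto simp: algebra_simps)
  have k4: "(k mod 4 = 0 \<or> k mod 4 = 1) \<longleftrightarrow> even a"
    unfolding a_def by presburger
  have e: "even e \<longleftrightarrow> (even a \<longleftrightarrow> even J)"
    unfolding e_def by auto
  have "(1 + 4 * e) mod 8 = (if even e then 1 else 5)"
  proof (cases "even e")
    case True
    then obtain b where "e = 2 * b" by (rule evenE)
    then show ?thesis by simp
  next
    case False
    then obtain b where "e = 2 * b + 1" by (rule oddE)
    then have "1 + 4 * e = 5 + b * 8" by simp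
    then show ?thesis using False by simp
  qed
  then show ?thesis unfolding D k4 e .
qed

text \<open>
  Put \<open>m = 2 k\<close>, \<open>n = 2 h\<close> with odd \<open>h\<close>, and let \<open>r\<close> be the remainder of \<open>k\<close> modulo \<open>h\<close>.  The two quotients differ
  if and only if \<open>r = 0\<close> or \<open>r = h - 1\<close>, and the two divisibilities say \<open>2 r = h + 1\<close> and \<open>2 r + 1 = h\<close>.  For
  \<open>h \<ge> 5\<close> these are exactly the four remainders for which \<open>2 k + 2\<close> leaves 2, 0, 3 or 1 modulo \<open>h\<close>.  For \<open>h = 3\<close> the values \<open>h - 1\<close>
  and \<open>(h + 1) / 2\<close> coincide and cancel; this is the origin of the exception at \<open>n = 6\<close>.
\<close>

lemma odd_half_trace_iff:
  fixes m n :: nat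
  assumes "even m" "n mod 4 = 2" "n > 2" "m \<ge> 2"
  shows "odd (half_trace m n) \<longleftrightarrow>
    (if n = 6 then (2 * m + 4) mod n \<noteq> 0 else (2 * m + 4) mod n \<le> 6)"
proof -
  obtain k where m: "m = 2 * k" using assms(1) by auto
  define h where "h = n div 2"
  have n: "n = 2 * h" and h: "odd h" "h \<ge> 3"
    using assms(2,3) unfolding h_def by presburger+
  define q r where "q = k div h" and "r = k mod h"
  have k: "k = q * h + r" and r: "r < h" using h by (simp_all add: q_def r_def)
  have k1: "k \<ge> 1" using assms(4) m by simp
  have up: "(m + 2) div n = q + of_bool (r = h - 1)"
  proof -
    have "(m + 2) div n = (k + 1) div h"
      unfolding m n using div_mult_mult1[of 2 "k + 1" h] by simp
    also have "k + 1 = (r + 1) + q * h" using k by simp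
    also have "(r + 1 + q * h) div h = q + (r + 1) div h"
      using h by (intro div_mult_self1) simp
    finally have "(m + 2) div n = q + (r + 1) div h" .
    then show ?thesis using r h by (auto simp: div_eq_0_iff)
  qed
  have down: "(m - 2) div n = q - of_bool (r = 0)"
  proof -
    have "(m - 2) div n = (k - 1) div h"
      unfolding m n using div_mult_mult1[of 2 "k - 1" h] by (simp add: right_diff_distrib')
    also have "\<dots> = q - of_bool (r = 0)"
    proof (cases "r = 0")
      case True
      then obtain q' where "q = Suc q'" using k k1 by (cases q) auto
      then have k': "k - 1 = (h - 1) + q' * h" using k True h by simp
      have "(k - 1) div h = q' + (h - 1) div h"
        unfolding k' using h by (intro div_mult_self1) simp
      then have "(k - 1) div h = q'" using h by simp
      then show ?thesis using True \<open>q = Suc q'\<close> by simp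
    next
      case False
      then have k': "k - 1 = (r - 1) + q * h" using k by simp
      have "(k - 1) div h = q + (r - 1) div h"
        unfolding k' using h by (intro div_mult_self1) simp
      then have "(k - 1) div h = q" using r by simp
      then show ?thesis using False by simp
    qed
    finally show ?thesis .
  qed
  have q_pos: "q \<ge> 1" if "r = 0" using that k k1 by (cases q) auto
  have dvd2: "n dvd 2 * m + 2 \<longleftrightarrow> 2 * r + 1 = h"
  proof -
    have "n dvd 2 * m + 2 \<longleftrightarrow> h dvd 2 * k + 1"
      unfolding m n using dvd_mult_cancel1[of 2 h] nat_mult_dvd_cancel1[of 2 h "2 * k + 1"] by simp
    also have "2 * k + 1 = (2 * r + 1) + h * (2 * q)" using k by simp
    also have "h dvd \<dots> \<longleftrightarrow> h dvd 2 * r + 1" by (simp only: dvd_add_left_iff dvd_triv_left)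
    also have "\<dots> \<longleftrightarrow> 2 * r + 1 = h"
    proof
      assume "h dvd 2 * r + 1"
      then obtain c where c: "2 * r + 1 = h * c" ..
      have "h * c < h * 2" unfolding c[symmetric] using r by linarith
      then have "c < 2" using mult_less_cancel1[of h c 2] by blast
      moreover have "c \<noteq> 0" using c by (intro notI) simp
      ultimately have "c = 1" by simp
      then show "2 * r + 1 = h" using c by simp
    qed auto
    finally show ?thesis .
  qed
  have dvd0: "n dvd 2 * m - 2 \<longleftrightarrow> 2 * r = h + 1"
  proof -
    have "n dvd 2 * m - 2 \<longleftrightarrow> h dvd 2 * k - 1"
      unfolding m n using nat_mult_dvd_cancel1[of 2 h "2 * k - 1"] by (simp add: right_diff_distrib')
    also have "\<dots> \<longleftrightarrow> h dvd 2 * k - 1 + h" by simp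
    also have "2 * k - 1 + h = (2 * r + h - 1) + h * (2 * q)"
    proof -
      have "2 * k = 2 * r + h * (2 * q)" using k by simp
      then show ?thesis using k1 h by linarith
    qed
    also have "h dvd \<dots> \<longleftrightarrow> h dvd 2 * r + h - 1" by (simp only: dvd_add_left_iff dvd_triv_left)
    also have "\<dots> \<longleftrightarrow> 2 * r = h + 1"
    proof
      assume "h dvd 2 * r + h - 1"
      then obtain c where c: "2 * r + h - 1 = h * c" ..
      have "h * c < h * 3" unfolding c[symmetric] using r by linarith
      then have "c < 3" using mult_less_cancel1[of h c 3] by blast
      moreover have "c \<noteq> 0" using c h by (intro notI) simp
      moreover have "c \<noteq> 1" using c h r by (intro notI) (simp, presburger)
      ultimately have "c = 2" by simp
      then show "2 * r = h + 1" using c h by simp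
    next
      assume "2 * r = h + 1"
      then have "2 * r + h - 1 = h * 2" by simp
      then show "h dvd 2 * r + h - 1" by simp
    qed
    finally show ?thesis .
  qed
  have md: "(2 * m + 4) mod n = 2 * ((2 * r + 2) mod h)"
  proof -
    have "(2 * m + 4) mod n = 2 * ((2 * k + 2) mod h)"
    proof -
      have "2 * (2 * k) + 4 = 2 * (2 * k + 2)" by simp
      then show ?thesis unfolding m n by (simp only: mult_mod_right)
    qed
    also have "2 * k + 2 = (2 * r + 2) + (2 * q) * h" using k by simp
    finally show ?thesis by (simp only: mod_mult_self1)
  qed
  have md': "(2 * r + 2) mod h = (if 2 * r + 2 < h then 2 * r + 2 else if r = h - 1 then 0 else 2 * r + 2 - h)"
  proof (cases "2 * r + 2 < h")
    case False
    show ?thesis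
    proof (cases "r = h - 1")
      case True
      then have "2 * r + 2 = h * 2" using h by simp
      then have "(2 * r + 2) mod h = 0" by simp
      then show ?thesis using False True by simp
    next
      case False
      then have "2 * r + 2 - h < h" using r by simp
      then show ?thesis using False \<open>\<not> 2 * r + 2 < h\<close> by (simp add: le_mod_geq)
    qed
  qed simp
  have par: "odd (half_trace m n) \<longleftrightarrow>
      odd (of_bool (2 * r = h + 1) + of_bool (2 * r + 1 = h) + of_bool (r = 0) + of_bool (r = h - 1) :: nat)"
    unfolding half_trace_def up down dvd0 dvd2 using q_pos by (cases "r = 0") auto
  show ?thesis
  proof (cases "n = 6")
    case True
    then have "h = 3" using n by simp
    then have "r = 0 \<or> r = 1 \<or> r = 2" using r by auto
    then show ?thesis using True \<open>h = 3\<close> unfolding par md md' by auto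
  next
    case False
    then have "h \<ge> 5" using n h by presburger
    then show ?thesis using False h(1) r unfolding par md md' by (auto split: if_splits; presburger)
  qed
qed

section \<open>The pentanomial over the field with two elements\<close>

lemma coprime_power_add_one:
  fixes u :: "'a::ring_gcd"
  shows "coprime (u + 1) (u ^ i)"
  by (simp add: coprime_power_right_iff)

text \<open>
  For even \<open>m\<close> and \<open>n\<close> the derivative is \<open>x^n + 1\<close>, and \<open>f = x^m + (x + 1) (x^n + 1)\<close>; so a repeated
  factor divides both \<open>x^n + 1\<close> and \<open>x^m\<close>.
\<close>

lemma squarefree_pentanomial:
  fixes f :: "gf2 poly"
  assumes "even m" "even n" "m > 0" "n > 0"
    and f: "f = monom 1 m + monom 1 (n + 1) + monom 1 n + monom 1 1 + 1"
  shows "squarefree f"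
  unfolding squarefree_def
proof (intro allI impI)
  fix q assume "q^2 dvd f"
  then obtain c where "f = q^2 * c" by (rule dvdE)
  then have c: "f = q * (q * c)" by (simp add: power2_eq_square mult.assoc)
  have even0: "of_nat i = (0 :: gf2)" if "even i" for i
    using that by (auto simp: add_self_eq_0 mult_2 elim!: evenE)
  have "pderiv f = monom 1 n + 1"
    unfolding f using assms(1,2) by (simp add: pderiv_add pderiv_monom even0)
  moreover have "q dvd pderiv f" unfolding c pderiv_mult by simp
  ultimately have q1: "q dvd monom 1 n + 1" by simp
  have "f = monom 1 m + (monom 1 1 + 1) * (monom 1 n + 1)"
    unfolding f by (simp add: algebra_simps mult_monom)
  then have "monom 1 m = f - (monom 1 1 + 1) * (monom 1 n + 1)" by simp
  then have "q dvd monom 1 m" using c q1 by (metis dvd_diff dvd_mult dvd_triv_left)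
  then have "q dvd (monom 1 m) ^ n" using \<open>n > 0\<close> by (metis dvd_trans dvd_power)
  then have "q dvd (monom 1 n) ^ m" by (simp add: monom_power mult.commute)
  then show "q dvd 1"
    using q1 coprime_power_add_one coprime_common_divisor by blast
qed

text \<open>
  Evaluating the polynomial at 0 and at \<open>- 1\<close> gives the products of the \<open>x\<close> and of the \<open>- 1 - x\<close> over the roots.
  With \<open>x^m = (- 1 - x) (x^n - 1)\<close> this yields the product of the \<open>x^n - 1\<close>, and what
  remains of \<open>x F'(x)\<close> has the form \<open>1 - 2 y\<close>.
\<close>

lemma prod_formal_deriv_roots_pentanomial:
  fixes xs :: "'a::comm_ring_1 list"
  assumes "roots_poly xs = pentanomial_lift m n" "even m" "even n" "n > 2" "2 * n + 2 \<le> m"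
    and "\<And>x. x \<in> set xs \<Longrightarrow> x * g x = 1" and "length xs = m" and "(8 :: 'a) = 0"
  shows "(\<Prod>x\<leftarrow>xs. poly (formal_deriv (roots_poly xs)) x) =
    of_int (1 - int m - 4 * (if odd (n div 2) then int (half_trace m n) else 0))"
proof -
  define k h p where "k = m div 2" and "h = n div 2" and "p = m - n - 1"
  have m: "m = 2 * k" and n: "n = 2 * h" using assms by (simp_all add: k_def h_def)
  have mp: "m = p + 1 + n" using assms by (simp add: p_def)
  have m_pos: "m > 0" and n_pos: "n > 0" using assms(4,5) by auto
  define y where "y z = of_nat k * (1 + z) + of_nat h * (1 + z)^2 * z ^ p" for z :: 'a
  have poly_eq: "poly (roots_poly xs) x = x ^ m + (x + 1) * (x ^ n - 1)" for x
    unfolding assms(1) pentanomial_lift_def by (simp add: poly_monom algebra_simps)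
  have root: "x ^ m = (- 1 - x) * (x ^ n - 1)" if "x \<in> set xs" for x
  proof -
    have "poly (roots_poly xs) x = 0"
      using that by (induction xs) auto
    then show ?thesis by (simp add: poly_eq algebra_simps)
  qed
  have prod_xs: "(\<Prod>x\<leftarrow>xs. x) = - 1"
  proof -
    have "(\<Prod>x\<leftarrow>xs. 0 - x) = -1"
      unfolding poly_roots_poly[symmetric] poly_eq using m_pos n_pos by (simp add: zero_power)
    moreover have "(\<Prod>x\<leftarrow>xs. x - 0) = (-1) ^ length xs * (\<Prod>x\<leftarrow>xs. 0 - x)"
      by (rule prod_list_diff_commute[of 0])
    ultimately show ?thesis using assms(2,7) by simp
  qed
  have prod_unit: "(\<Prod>x\<leftarrow>xs. x ^ n - 1) = 1"
  proof -
    have "(\<Prod>x\<leftarrow>xs. x ^ i) = (\<Prod>x\<leftarrow>xs. x) ^ i" for i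
      by (induction xs) (simp_all add: power_mult_distrib)
    then have "1 = (\<Prod>x\<leftarrow>xs. x ^ m)" using prod_xs assms(2) by simp
    also have "\<dots> = (\<Prod>x\<leftarrow>xs. (- 1 - x) * (x ^ n - 1))"
      using root by (metis (mono_tags, lifting) map_eq_conv)
    also have "\<dots> = (\<Prod>x\<leftarrow>xs. - 1 - x) * (\<Prod>x\<leftarrow>xs. x ^ n - 1)"
      by (rule prod_list_mult_distrib)
    also have "(\<Prod>x\<leftarrow>xs. - 1 - x) = 1"
      unfolding poly_roots_poly[symmetric] poly_eq using assms(2) by simp
    finally show ?thesis by simp
  qed
  have deriv: "x * poly (formal_deriv (roots_poly xs)) x = x * (x ^ n - 1) * (1 - 2 * y (g x))"
    if x: "x \<in> set xs" for x
  proof -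
    define z w where "z = g x" and "w = x ^ n"
    have xz: "x * z = 1" using assms(6) x by (simp add: z_def)
    have x_pow: "x * x ^ (i - 1) = x ^ i" if "i > 0" for i using that by (cases i) simp_all
    have "x * poly (formal_deriv (roots_poly xs)) x =
        of_nat m * x ^ m + of_nat (n + 1) * (x * w) + of_nat n * w - x"
      unfolding assms(1) pentanomial_lift_def w_def using assms(4,5) x_pow[of m] x_pow[of n]
      by (simp add: formal_deriv_add formal_deriv_diff formal_deriv_monom poly_monom right_diff_distrib
          distrib_left mult.left_commute[of x])
    then have lhs: "x * poly (formal_deriv (roots_poly xs)) x =
        x * (w - 1) - 2 * of_nat k * (w - 1) * (x + 1) + 2 * of_nat h * w * (1 + x)"
      unfolding root[OF x] w_def[symmetric] by (simp add: m n algebra_simps)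
    have z1: "1 + z = z * (x + 1)" using xz by (simp add: algebra_simps)
    have "(1 - w) * (1 + z) * z ^ p = z ^ (p + 1) * ((- 1 - x) * (w - 1))"
      unfolding z1 by (simp add: algebra_simps)
    also have "\<dots> = (x * z) ^ (p + 1) * w"
      unfolding w_def root[OF x, symmetric] mp power_mult_distrib by (simp add: power_add)
    finally have zp: "(1 - w) * (1 + z) * z ^ p = w" unfolding xz by simp
    have "x * (w - 1) * (1 - 2 * y z) =
        x * (w - 1) - 2 * of_nat k * (w - 1) * (x * (1 + z))
        + 2 * of_nat h * ((1 - w) * (1 + z) * z ^ p) * (x * (1 + z))"
      unfolding y_def by (simp add: power2_eq_square algebra_simps)
    also have "x * (1 + z) = x + 1" using xz by (simp add: algebra_simps)
    finally show ?thesis unfolding zp lhs z_def[symmetric] w_def[symmetric] by (simp add: add.commute)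
  qed
  have "(\<Prod>x\<leftarrow>xs. x) * (\<Prod>x\<leftarrow>xs. poly (formal_deriv (roots_poly xs)) x) =
      (\<Prod>x\<leftarrow>xs. x * (x ^ n - 1) * (1 - 2 * y (g x)))"
    unfolding prod_list_mult_distrib[symmetric]
    using deriv by (intro arg_cong[of _ _ prod_list] map_cong refl) simp
  also have "\<dots> = (\<Prod>x\<leftarrow>xs. x) * (\<Prod>x\<leftarrow>xs. x ^ n - 1) * (\<Prod>x\<leftarrow>xs. 1 - 2 * y (g x))"
    by (simp only: prod_list_mult_distrib)
  finally have "(\<Prod>x\<leftarrow>xs. poly (formal_deriv (roots_poly xs)) x) = (\<Prod>y\<leftarrow>map (\<lambda>x. y (g x)) xs. 1 - 2 * y)"
    unfolding prod_xs prod_unit by (simp add: o_def)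
  also have "\<dots> = 1 - 2 * (\<Sum>x\<leftarrow>xs. y (g x)) + 2 * (\<Sum>x\<leftarrow>xs. y (g x))^2 - 2 * (\<Sum>x\<leftarrow>xs. (y (g x))^2)"
    unfolding prod_one_minus_two_mult[OF assms(8)] by (simp add: o_def)
  finally have main: "(\<Prod>x\<leftarrow>xs. poly (formal_deriv (roots_poly xs)) x) = \<dots>" .
  define s where "s = inverse_power_sum m n"
  have S: "(\<Sum>x\<leftarrow>xs. g x ^ j) = of_int (s j)" if "0 < j" "j < 2 * m" for j
    unfolding s_def using assms that by (intro power_sums_inverse_roots_pentanomial) auto
  have len: "(\<Sum>x\<leftarrow>xs. 1) = (of_int (int m) :: 'a)"
    using assms(7) by (simp add: sum_list_triv)
  define t1 where "t1 = int k * (int m + s 1) + int h * (s p + 2 * s (p + 1) + s (p + 2))"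
  define t2 where "t2 = (int k)^2 * (int m + 2 * s 1 + s 2)
    + 2 * int k * int h * (s p + 3 * s (p + 1) + 3 * s (p + 2) + s (p + 3))
    + (int h)^2 * (s (2 * p) + 4 * s (2 * p + 1) + 6 * s (2 * p + 2) + 4 * s (2 * p + 3) + s (2 * p + 4))"
  have p_bounds: "0 < p" "2 * p + 4 < 2 * m" using assms by (simp_all add: p_def)
  have y1: "y z = of_nat k * (1 + z ^ 1) + of_nat h * (z ^ p + 2 * z ^ (p + 1) + z ^ (p + 2))" for z
    unfolding y_def by (simp add: power2_eq_square power_add algebra_simps)
  note sums = sum_list_addf sum_list_const_mult len
  note of_ints = of_int_add of_int_mult of_int_power of_int_numeral of_int_of_nat_eq
  have S': "(\<Sum>x\<leftarrow>xs. g x ^ 1) = of_int (s 1)" "(\<Sum>x\<leftarrow>xs. g x ^ 2) = of_int (s 2)"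
    "(\<Sum>x\<leftarrow>xs. g x ^ p) = of_int (s p)"
    "(\<Sum>x\<leftarrow>xs. g x ^ (p + 1)) = of_int (s (p + 1))"
    "(\<Sum>x\<leftarrow>xs. g x ^ (p + 2)) = of_int (s (p + 2))"
    "(\<Sum>x\<leftarrow>xs. g x ^ (p + 3)) = of_int (s (p + 3))"
    "(\<Sum>x\<leftarrow>xs. g x ^ (2 * p)) = of_int (s (2 * p))"
    "(\<Sum>x\<leftarrow>xs. g x ^ (2 * p + 1)) = of_int (s (2 * p + 1))"
    "(\<Sum>x\<leftarrow>xs. g x ^ (2 * p + 2)) = of_int (s (2 * p + 2))"
    "(\<Sum>x\<leftarrow>xs. g x ^ (2 * p + 3)) = of_int (s (2 * p + 3))"
    "(\<Sum>x\<leftarrow>xs. g x ^ (2 * p + 4)) = of_int (s (2 * p + 4))"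
    by (rule S; use p_bounds in linarith)+
  have T1: "(\<Sum>x\<leftarrow>xs. y (g x)) = of_int t1"
    unfolding y1 t1_def by (simp only: sums S' of_ints)
  have y2: "(y z)^2 = (of_nat k)^2 * (1 + 2 * z ^ 1 + z ^ 2)
    + 2 * of_nat k * of_nat h * (z ^ p + 3 * z ^ (p + 1) + 3 * z ^ (p + 2) + z ^ (p + 3))
    + (of_nat h)^2 * (z ^ (2 * p) + 4 * z ^ (2 * p + 1) + 6 * z ^ (2 * p + 2) + 4 * z ^ (2 * p + 3) + z ^ (2 * p + 4))" for z
  proof -
    define q v where "q = z ^ p" and "v = 1 + z"
    have p2: "z ^ (2 * p) = q^2" unfolding q_def by (simp add: mult.commute flip: power_mult)
    have "(y z)^2 = (of_nat k)^2 * (1 + z)^2 + 2 * of_nat k * of_nat h * ((1 + z)^3 * q)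
        + (of_nat h)^2 * ((1 + z)^4 * q^2)"
      unfolding y_def q_def[symmetric] v_def[symmetric]
      by (simp add: power2_eq_square power3_eq_cube power4_eq_xxxx algebra_simps)
    also have "(1 + z)^2 = 1 + 2 * z ^ 1 + z ^ 2"
      by (simp add: power2_eq_square algebra_simps)
    also have "(1 + z)^3 * q = z ^ p + 3 * z ^ (p + 1) + 3 * z ^ (p + 2) + z ^ (p + 3)"
      unfolding power_add q_def[symmetric] by (simp add: power2_eq_square power3_eq_cube algebra_simps)
    also have "(1 + z)^4 * q^2 = z ^ (2 * p) + 4 * z ^ (2 * p + 1) + 6 * z ^ (2 * p + 2)
        + 4 * z ^ (2 * p + 3) + z ^ (2 * p + 4)"
      unfolding power_add p2
      by (simp add: power2_eq_square power3_eq_cube power4_eq_xxxx algebra_simps)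
    finally show ?thesis .
  qed
  have T2: "(\<Sum>x\<leftarrow>xs. (y (g x))^2) = of_int t2"
    unfolding y2 t2_def by (simp only: sums S' of_ints)
  have "8 dvd (1 - 2 * t1 + 2 * t1^2 - 2 * t2)
      - (1 - 2 * int k - 4 * (if odd (n div 2) then int (half_trace m n) else 0))"
    using trace_expression_mod_8[OF assms(2,3,4,5) p_def]
    unfolding t1_def t2_def s_def k_def h_def by (simp only: even_of_nat)
  then obtain c where "(1 - 2 * t1 + 2 * t1^2 - 2 * t2)
      - (1 - 2 * int k - 4 * (if odd (n div 2) then int (half_trace m n) else 0)) = 8 * c"
    by (rule dvdE)
  moreover have "int m = 2 * int k" unfolding m by simp
  ultimately have c: "1 - 2 * t1 + 2 * t1^2 - 2 * t2 =
      1 - int m - 4 * (if odd (n div 2) then int (half_trace m n) else 0) + 8 * c"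
    by linarith
  have "(\<Prod>x\<leftarrow>xs. poly (formal_deriv (roots_poly xs)) x) = of_int (1 - 2 * t1 + 2 * t1^2 - 2 * t2)"
    unfolding main T1 T2 by simp
  also have "\<dots> = of_int (1 - int m - 4 * (if odd (n div 2) then int (half_trace m n) else 0))"
    unfolding c of_int_add of_int_mult using assms(8) by simp
  finally show ?thesis .
qed

text \<open>
  For even \<open>m\<close> the criterion asks whether the discriminant is 1 modulo 8.  It is
  \<open>(-1)^(m / 2) (1 - m)\<close> modulo 8, shifted by 4 when \<open>n / 2\<close> and the half trace are odd; the unshifted value is 1
  exactly for \<open>m\<close> congruent to 0 or 2 modulo 8.
\<close>

theorem even_num_irreducible_factors_pentanomial:
  fixes m n :: nat and f :: "gf2 poly"
  assumes "even m" "even n" "n > 2" "2 * n + 2 \<le> m"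
    and f: "f = monom 1 m + monom 1 (n + 1) + monom 1 n + monom 1 1 + 1"
  shows "even (num_irreducible_factors f) \<longleftrightarrow>
    ((m mod 8 = 0 \<or> m mod 8 = 2) \<longleftrightarrow> \<not> (odd (n div 2) \<and> odd (half_trace m n)))"
proof -
  have coeff_lift: "coeff (pentanomial_lift m n :: 'a::comm_ring_1 poly) i =
      of_bool (i = m) + of_bool (i = n + 1) + of_bool (i = n) - of_bool (i = 1) - of_bool (i = 0)" for i
    by (auto simp: pentanomial_lift_def coeff_1)
  have deg_lift: "degree (pentanomial_lift m n :: int poly) = m"
  proof (rule antisym)
    show "degree (pentanomial_lift m n :: int poly) \<le> m"
      using assms by (intro degree_le) (auto simp: coeff_lift)
    show "m \<le> degree (pentanomial_lift m n :: int poly)"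
      using assms by (intro le_degree) (auto simp: coeff_lift)
  qed
  have lc: "lead_coeff (pentanomial_lift m n :: int poly) = 1"
    unfolding deg_lift using assms by (auto simp: coeff_lift)
  have map_lift: "map_poly of_int (pentanomial_lift m n) = (pentanomial_lift m n :: 'a::comm_ring_1 poly)"
    by (rule poly_eqI) (simp add: coeff_map_poly coeff_lift)
  have f_lift: "f = map_poly of_int (pentanomial_lift m n)"
    unfolding map_lift f pentanomial_lift_def
    by (rule poly_eqI) (simp add: diff_eq_plus coeff_1)
  have sf: "squarefree f" using squarefree_pentanomial[of m n f] assms by simp
  have f0: "f \<noteq> 0"
    using lc by (metis f_lift coeff_map_poly of_int_0 of_int_1 coeff_0 zero_neq_one)
  define r where "r = num_irreducible_factors f"
  have r: "r = size (prime_factorization f)"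
    unfolding r_def by (rule num_irreducible_factors_eq_size_prime_factorization[OF f0])
  obtain xs :: "gf2 alg_closure witt3 list" where xs: "map_poly of_int (pentanomial_lift m n) = roots_poly xs"
    "length xs = degree (pentanomial_lift m n :: int poly)" "(vandermonde xs)^2 = (if even (degree (pentanomial_lift m n :: int poly) + r) then 1 else 5)"
    using stickelberger_swan[OF lc f_lift sf] unfolding r by metis
  have len: "length xs = m" using xs(2) deg_lift by simp
  have roots: "roots_poly xs = pentanomial_lift m n" using xs(1) map_lift by metis
  \<comment> \<open>the inverse of a root, read off from the equation that the root satisfies\<close>
  define g where "g x = x ^ (m - 1) + x ^ n + x ^ (n - 1) - 1" for x :: "gf2 alg_closure witt3"
  have g: "x * g x = 1" if "x \<in> set xs" for x
  proof -
    have x_pow: "x * x ^ (i - 1) = x ^ i" if "i > 0" for i using that by (cases i) simp_all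
    have "poly (roots_poly xs) x = 0" using that by (induction xs) auto
    then have "x ^ m + x * x ^ n + x ^ n - x - 1 = 0"
      unfolding roots pentanomial_lift_def by (simp add: poly_monom)
    then show ?thesis
      unfolding g_def using x_pow[of m] x_pow[of n] assms by (simp add: algebra_simps)
  qed
  define J where "J = (if odd (n div 2) then int (half_trace m n) else 0)"
  have "(-1) ^ (m * (m - 1) div 2) * (vandermonde xs)^2 = of_int (1 - int m - 4 * J)"
    using prod_formal_deriv_roots_pentanomial[OF roots assms(1-4) g len witt3_eight]
    unfolding prod_formal_deriv_roots len J_def .
  then have "(-1) ^ (m * (m - 1) div 2) * ((-1) ^ (m * (m - 1) div 2) * (vandermonde xs)^2) =
      of_int ((-1) ^ (m * (m - 1) div 2) * (1 - int m - 4 * J))"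
    by simp
  then have V: "(vandermonde xs)^2 = of_int ((-1) ^ (m * (m - 1) div 2) * (1 - int m - 4 * J))"
    by (simp add: mult.assoc[symmetric] flip: power_mult_distrib)
  obtain k where k: "m = 2 * k" using assms(1) by auto
  have "even (m * (m - 1) div 2) \<longleftrightarrow> even k" using k assms by (cases k) auto
  then have sign: "(-1) ^ (m * (m - 1) div 2) = (if even k then 1 else - 1 :: int)" by simp
  define D where "D = (if even k then 1 - int m - 4 * J else - (1 - int m - 4 * J))"
  have "(vandermonde xs)^2 = of_int (8 * (D div 8) + D mod 8)"
    unfolding V sign D_def by simp
  then have VD: "(vandermonde xs)^2 = of_int (D mod 8)"
    unfolding of_int_add of_int_mult by (simp add: witt3_eight)
  define P where "P \<longleftrightarrow> ((m mod 8 = 0 \<or> m mod 8 = 2) \<longleftrightarrow> even J)"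
  have "D = (if even (int k) then 1 - 2 * int k - 4 * J else - (1 - 2 * int k - 4 * J))"
    unfolding D_def k by simp
  moreover have "m mod 8 = 0 \<or> m mod 8 = 2 \<longleftrightarrow> int k mod 4 = 0 \<or> int k mod 4 = 1"
  proof -
    have "m mod 8 = 2 * (k mod 4)" unfolding k using mult_mod_right[of 2 k 4] by simp
    moreover have "int k mod 4 = int (k mod 4)" by (simp add: zmod_int)
    ultimately show ?thesis by auto
  qed
  ultimately have "D mod 8 = (if P then 1 else 5)"
    unfolding P_def by (simp only: signed_discriminant_mod_8)
  then have "(if even (m + r) then 1 else 5) = (if P then 1 else 5 :: gf2 alg_closure witt3)"
    using VD xs(3) unfolding deg_lift by simp
  moreover have "(1 :: gf2 alg_closure witt3) \<noteq> 5"
  proof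
    assume "(1 :: gf2 alg_closure witt3) = 5"
    then have "1 = 1 + (4 :: gf2 alg_closure witt3)" by (rule trans) simp
    then show False using witt3_four_neq_0[where 'a = "gf2 alg_closure"] by (simp only: add_cancel_right_right)
  qed
  ultimately have "even r \<longleftrightarrow> P" using assms(1) by (auto split: if_splits)
  then show ?thesis unfolding r_def P_def J_def by auto
qed

theorem theorem3p2:
  fixes m n :: nat and f :: "gf2 poly"
  assumes "m > 0" and "n > 0"
    and "even n" and "2 \<le> n" and "n \<le> m div 2 - 1"
    and "f = monom 1 m + monom 1 (n + 1) + monom 1 n + monom 1 1 + 1"
    and "even m" and "n > 2"
  shows "even (num_irreducible_factors f) \<longleftrightarrow>
      (n mod 4 = 0 \<and> (m mod 8 = 0 \<or> m mod 8 = 2))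
    \<or> (n \<noteq> 6 \<and> n mod 4 = 2 \<and>
        (((2 * m + 4) mod n \<le> 6 \<and> (m mod 8 = 4 \<or> m mod 8 = 6))
         \<or> ((2 * m + 4) mod n > 6 \<and> (m mod 8 = 0 \<or> m mod 8 = 2))))
    \<or> (n = 6 \<and>
        (((2 * m + 4) mod n = 0 \<and> (m mod 8 = 0 \<or> m mod 8 = 2))
         \<or> ((2 * m + 4) mod n \<noteq> 0 \<and> (m mod 8 = 4 \<or> m mod 8 = 6))))"
proof -
  have "2 * n + 2 \<le> m" using assms(4,5) by linarith
  then have parity: "even (num_irreducible_factors f) \<longleftrightarrow>
      ((m mod 8 = 0 \<or> m mod 8 = 2) \<longleftrightarrow> \<not> (odd (n div 2) \<and> odd (half_trace m n)))"
    using assms by (intro even_num_irreducible_factors_pentanomial) auto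
  have residues: "m mod 8 = 4 \<or> m mod 8 = 6 \<longleftrightarrow> \<not> (m mod 8 = 0 \<or> m mod 8 = 2)"
    using \<open>even m\<close> by presburger
  show ?thesis
  proof (cases "n mod 4 = 0")
    case True
    then have "even (n div 2)" "n \<noteq> 6" by presburger+
    then show ?thesis using True unfolding parity by simp
  next
    case False
    then have n: "n mod 4 = 2" "odd (n div 2)" using \<open>even n\<close> by presburger+
    have "odd (half_trace m n) \<longleftrightarrow>
        (if n = 6 then (2 * m + 4) mod n \<noteq> 0 else (2 * m + 4) mod n \<le> 6)"
      using odd_half_trace_iff[of m n] n(1) assms by auto
    then show ?thesis using n unfolding parity residues by (cases "n = 6") auto
  qed
qed

end
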